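(* Let $N\ge 2$, $R>0$, and let $f\in L^{N,\infty}(B_R)$ be non-negative, radially symmetric and radially decreasing. Let $p>1$ and let $u_p\in W^{1,p}_0(B_R)$ be a weak solution of $$-\mathrm{div}\left((|\nabla u_p|-1)_+^{p-1}\frac{\nabla u_p}{|\nabla u_p|}\right)=f\ \text{ in } B_R,\qquad u_p=0\ \text{ on }\partial B_R .$$ Then $$\frac{(|\nabla u_p|-1)_+}{|\nabla u_p|}\,\nabla u_p=-\left(\frac{|x|}{N}f^{**}(C_N|x|^N)\right)^{\frac1{p-1}}\frac{x}{|x|}\qquad\text{for a.e. }x\in B_R,$$ and consequently $$\nabla u_p=-\left[1+\left(\frac{|x|}{N}f^{**}(C_N|x|^N)\right)^{\frac1{p-1}}\right]\frac{x}{|x|}$$ a.e. in the set $\{x\in B_R: |\nabla u_p(x)|>1\}$.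
   Context: $B_R=\{x\in\mathbb{R}^N:|x|<R\}$, $C_N$ is the Lebesgue measure of the unit ball of $\mathbb{R}^N$, and $(\cdot)_+$ is the positive part. For $\alpha>0$ put $H_\alpha(\xi)=(|\xi|-1)_+^{\alpha}\frac{\xi}{|\xi|}$ if $\xi\in\mathbb{R}^N\setminus\{0\}$ and $H_\alpha(0)=0$ (so expressions such as $(|\nabla u|-1)_+\nabla u/|\nabla u|$ are understood as $0$ where $\nabla u=0$). Weak solution: $u\in W^{1,p}_0(B_R)$ is a weak solution of the Dirichlet problem if $\int_{B_R}\langle H_{p-1}(\nabla u),\nabla\varphi\rangle\,dx=\int_{B_R}f\varphi\,dx$ for all $\varphi\in C_0^\infty(B_R)$. Rearrangements: for measurable $f:B_R\to\mathbb{R}$, $\mu_f(\tau)=|\{x\in B_R:|f(x)|>\tau\}|$ for $\tau\ge0$; $f^*(\lambda)=\inf\{\tau\ge0:\mu_f(\tau)\le\lambda\}$ for $\lambda\ge0$; $f^{**}(t)=\frac1t\int_0^t f^*(s)\,ds$ for $t>0$. Lorentz space: for $1<r<\infty$, $L^{r,\infty}(B_R)$ is the set of measurable $f$ with $\|f\|_{L^{r,\infty}}=\sup_{0<t<\infty}t^{1/r}f^{**}(t)<\infty$. "Radially decreasing" means that $f(x)$ depends only on $|x|$ and is a non-increasing function of $|x|$. *)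

theory Defs
  imports "HOL-Analysis.Analysis"
begin

subsection \<open>Test functions and Sobolev spaces\<close>

text \<open>\<^term>\<open>Ck k \<phi>\<close>: all directional derivatives of order at most \<open>k\<close> of \<open>\<phi>\<close> exist and are continuous
  on the whole space.\<close>

primrec Ck :: "nat \<Rightarrow> ('a::euclidean_space \<Rightarrow> real) \<Rightarrow> bool" where
  "Ck 0 \<phi> \<longleftrightarrow> continuous_on UNIV \<phi>"
| "Ck (Suc k) \<phi> \<longleftrightarrow> (\<forall>x. \<phi> differentiable (at x)) \<and>
      (\<forall>v. Ck k (\<lambda>x. frechet_derivative \<phi> (at x) v))"

text \<open>\<open>C\<^sub>0\<^sup>\<infinity>(\<Omega>)\<close>; a test function is identified with its extension by zero to the whole space.\<close>

definition test_functions :: "'a::euclidean_space set \<Rightarrow> ('a \<Rightarrow> real) set" where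
  "test_functions \<Omega> =
    {\<phi>. (\<forall>k. Ck k \<phi>) \<and> compact (closure {x. \<phi> x \<noteq> 0}) \<and> closure {x. \<phi> x \<noteq> 0} \<subseteq> \<Omega>}"

definition grad :: "('a::euclidean_space \<Rightarrow> real) \<Rightarrow> 'a \<Rightarrow> 'a" where
  "grad \<phi> x = (\<Sum>b\<in>Basis. frechet_derivative \<phi> (at x) b *\<^sub>R b)"

definition locally_integrable_on ::
    "('a::euclidean_space \<Rightarrow> 'b::euclidean_space) \<Rightarrow> 'a set \<Rightarrow> bool" (infix "locally'_integrable'_on" 50)
  where "h locally_integrable_on \<Omega> \<longleftrightarrow>
    (\<forall>K. compact K \<and> K \<subseteq> \<Omega> \<longrightarrow> h absolutely_integrable_on K)"

text \<open>Weak gradients are only determined up to null sets, so this is a relation: \<open>Du\<close> is a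
  representative of the distributional gradient of \<open>u\<close> on \<open>\<Omega>\<close>. The vector identity collects the
  integration-by-parts formulas for all partial derivatives.\<close>

definition has_weak_gradient ::
    "'a::euclidean_space set \<Rightarrow> ('a \<Rightarrow> real) \<Rightarrow> ('a \<Rightarrow> 'a) \<Rightarrow> bool" where
  "has_weak_gradient \<Omega> u Du \<longleftrightarrow>
    u locally_integrable_on \<Omega> \<and> Du locally_integrable_on \<Omega> \<and>
    (\<forall>\<phi>\<in>test_functions \<Omega>.
      (\<integral>x. u x *\<^sub>R grad \<phi> x \<partial>lebesgue_on \<Omega>) = - (\<integral>x. \<phi> x *\<^sub>R Du x \<partial>lebesgue_on \<Omega>))"

definition Lp_on ::
    "'a::euclidean_space set \<Rightarrow> real \<Rightarrow> ('a \<Rightarrow> 'b::euclidean_space) set" where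
  "Lp_on \<Omega> p = {h. h \<in> borel_measurable (lebesgue_on \<Omega>) \<and>
    integrable (lebesgue_on \<Omega>) (\<lambda>x. norm (h x) powr p)}"

definition sobolev_W1 :: "'a::euclidean_space set \<Rightarrow> real \<Rightarrow> ('a \<Rightarrow> real) set" where
  "sobolev_W1 \<Omega> p = {u. u \<in> Lp_on \<Omega> p \<and> (\<exists>Du. has_weak_gradient \<Omega> u Du \<and> Du \<in> Lp_on \<Omega> p)}"

text \<open>\<open>W\<^sub>0\<^sup>1\<^sup>,\<^sup>p(\<Omega>)\<close>: the closure of the test functions in the norm of \<open>W\<^sup>1\<^sup>,\<^sup>p(\<Omega>)\<close>.\<close>

definition sobolev_W1_0 :: "'a::euclidean_space set \<Rightarrow> real \<Rightarrow> ('a \<Rightarrow> real) set" where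
  "sobolev_W1_0 \<Omega> p = {u \<in> sobolev_W1 \<Omega> p.
    \<exists>Du \<phi>. has_weak_gradient \<Omega> u Du \<and> Du \<in> Lp_on \<Omega> p \<and>
      (\<forall>n. \<phi> n \<in> test_functions \<Omega>) \<and>
      (\<lambda>n::nat. (\<integral>x. \<bar>\<phi> n x - u x\<bar> powr p \<partial>lebesgue_on \<Omega>)
               + (\<integral>x. norm (grad (\<phi> n) x - Du x) powr p \<partial>lebesgue_on \<Omega>)) \<longlonglongrightarrow> 0}"

subsection \<open>The Dirichlet problem\<close>

definition H :: "real \<Rightarrow> 'a::euclidean_space \<Rightarrow> 'a" where
  "H \<alpha> \<xi> = (if \<xi> = 0 then 0 else (max 0 (norm \<xi> - 1) powr \<alpha>) *\<^sub>R (\<xi> /\<^sub>R norm \<xi>))"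

text \<open>\<open>u\<close> is a weak solution of \<open>- div H\<^bsub>p-1\<^esub>(\<nabla>u) = f\<close> in \<open>\<Omega>\<close>, \<open>u = 0\<close> on the boundary of \<open>\<Omega>\<close>, and \<open>Du\<close> is a
  representative of its weak gradient.\<close>

definition weak_solution ::
    "'a::euclidean_space set \<Rightarrow> real \<Rightarrow> ('a \<Rightarrow> real) \<Rightarrow> ('a \<Rightarrow> real) \<Rightarrow> ('a \<Rightarrow> 'a) \<Rightarrow> bool" where
  "weak_solution \<Omega> p f u Du \<longleftrightarrow>
    u \<in> sobolev_W1_0 \<Omega> p \<and> has_weak_gradient \<Omega> u Du \<and>
    (\<forall>\<phi>\<in>test_functions \<Omega>.
      (\<integral>x. H (p - 1) (Du x) \<bullet> grad \<phi> x \<partial>lebesgue_on \<Omega>) = (\<integral>x. f x * \<phi> x \<partial>lebesgue_on \<Omega>))"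

subsection \<open>Rearrangements and the Lorentz spaces\<close>

definition distr_fun :: "'a::euclidean_space set \<Rightarrow> ('a \<Rightarrow> real) \<Rightarrow> real \<Rightarrow> ennreal" where
  "distr_fun \<Omega> f \<tau> = emeasure (lebesgue_on \<Omega>) {x \<in> \<Omega>. \<bar>f x\<bar> > \<tau>}"

text \<open>Values are in \<^typ>\<open>ennreal\<close>, so that the infimum of the empty set (which occurs at \<open>s = 0\<close> if \<open>f\<close>
  is unbounded) is \<open>\<infinity>\<close>.\<close>

definition rearr :: "'a::euclidean_space set \<Rightarrow> ('a \<Rightarrow> real) \<Rightarrow> real \<Rightarrow> ennreal" where
  "rearr \<Omega> f s = (INF \<tau>\<in>{\<tau>. 0 \<le> \<tau> \<and> distr_fun \<Omega> f \<tau> \<le> ennreal s}. ennreal \<tau>)"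

definition max_rearr :: "'a::euclidean_space set \<Rightarrow> ('a \<Rightarrow> real) \<Rightarrow> real \<Rightarrow> ennreal" where
  "max_rearr \<Omega> f t = (\<integral>\<^sup>+s\<in>{0..t}. rearr \<Omega> f s \<partial>lborel) / ennreal t"

definition weak_lorentz_norm :: "'a::euclidean_space set \<Rightarrow> real \<Rightarrow> ('a \<Rightarrow> real) \<Rightarrow> ennreal" where
  "weak_lorentz_norm \<Omega> r f = (SUP t\<in>{0<..}. ennreal (t powr (1 / r)) * max_rearr \<Omega> f t)"

definition weak_lorentz :: "'a::euclidean_space set \<Rightarrow> real \<Rightarrow> ('a \<Rightarrow> real) set" where
  "weak_lorentz \<Omega> r = {f \<in> borel_measurable (lebesgue_on \<Omega>). weak_lorentz_norm \<Omega> r f < \<infinity>}"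

text \<open>A radially decreasing function on the ball is in particular radially symmetric. Functions in
  Lorentz spaces are classes modulo null sets, so the condition is imposed almost everywhere and
  the profile \<open>g\<close> lives on the open interval: requiring it pointwise at the origin would bound \<open>f\<close>
  by the real number \<open>f 0\<close> and exclude functions such as \<open>1 / norm x\<close>.\<close>

definition radially_decreasing :: "real \<Rightarrow> ('a::euclidean_space \<Rightarrow> real) \<Rightarrow> bool" where
  "radially_decreasing R f \<longleftrightarrow>
    (\<exists>g. antimono_on {0<..<R} g \<and> (AE x in lebesgue_on (ball 0 R). f x = g (norm x)))"

text \<open>The pointwise length \<open>norm x / N * f\<^sup>*\<^sup>*(C\<^sub>N * norm x ^ N)\<close>. For \<open>f\<close> in a space
  \<^term>\<open>weak_lorentz \<Omega> r\<close>, the value of \<^term>\<open>max_rearr \<Omega> f t\<close> is finite for every \<open>t > 0\<close>, so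
  \<^const>\<open>enn2real\<close> loses nothing for \<open>x \<noteq> 0\<close>.\<close>

definition flux :: "real \<Rightarrow> (real ^ 'n \<Rightarrow> real) \<Rightarrow> real ^ 'n \<Rightarrow> real" where
  "flux R f x = norm x / CARD('n) *
    enn2real (max_rearr (ball 0 R) f
      (measure lebesgue (ball 0 1 :: (real ^ 'n) set) * norm x ^ CARD('n)))"

end

theory Submission
  imports Defs
begin

text \<open>Write \<open>g\<close> for the radial profile of \<open>f\<close>. Off a countable set \<open>f\<^sup>*(C\<^sub>N \<sigma>\<^sup>N) = g(\<sigma>)\<close>, so the vector field
  \<open>V(x) = (\<bar>x\<bar> / N) f\<^sup>*\<^sup>*(C\<^sub>N \<bar>x\<bar>\<^sup>N) x / \<bar>x\<bar>\<close> equals \<open>x \<integral>\<^sub>0\<^sup>1 g(s \<bar>x\<bar>) s\<^bsup>N-1\<^esup> ds\<close>, and a dilation under the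
  integral shows \<open>div V = f\<close> weakly; it is bounded because \<open>f\<close> lies in the Lorentz space. Hence
  \<open>F = H\<^bsub>p-1\<^esub>(\<nabla>u) + V\<close> annihilates the gradients of test functions, therefore also \<open>\<nabla>u\<close>, and,
  testing with \<open>G(\<bar>x\<bar>\<^sup>2)\<close>, every bounded continuous radial field \<open>w(\<bar>x\<bar>) x / \<bar>x\<bar>\<close>. With
  \<open>w = 1 + \<bar>V\<bar>\<^bsup>1/(p-1)\<^esup>\<close>, so that \<open>H\<^bsub>p-1\<^esub>\<close> maps \<open>- w x / \<bar>x\<bar>\<close> to \<open>- V\<close>, the integral of
  \<open>F \<bullet> (\<nabla>u + w x / \<bar>x\<bar>)\<close> vanishes, and the equality case in the monotonicity of \<open>H\<^bsub>p-1\<^esub>\<close> gives the formula.\<close>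

subsection \<open>Smooth functions\<close>

text \<open>Where the gradient has length at most 1 the equation does not determine it (for f = 0
  every u with |grad u| <= 1 is a solution), so u cannot be assumed radial and no ODE for a profile
  of u is available. The field - w x / |x| stands for the gradient of one radial solution. Comparing
  with it through \<open>H\<close> determines exactly what the equation sees, which is why the
  conclusion is about \<open>H 1\<close>.

  The exponent N of the Lorentz space is the scaling for which |V| is bounded. Boundedness places V
  in the dual of every L^p with p > 1 and makes w an admissible bounded weight.

  The obstacle is regularity: the profile g may jump and w is treated as merely continuous, while
  only smooth compactly supported functions may be tested with. Hence g is never differentiated (the
  dilation puts all derivatives on the test function), and radial fields are reached through
  polynomials in |x|^2, which are smooth at the origin, with smooth cutoffs and the
  Stone-Weierstrass theorem.\<close>

definition smooth_real :: "(real \<Rightarrow> real) \<Rightarrow> bool" where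
  "smooth_real h \<longleftrightarrow>
    (\<exists>D. D (0::nat) = h \<and> (\<forall>n t. (D n has_real_derivative D (Suc n) t) (at t)))"

lemma smooth_realE:
  assumes "smooth_real h"
  obtains h' where "smooth_real h'" "\<And>t. (h has_real_derivative h' t) (at t)"
proof -
  obtain D where D: "D (0::nat) = h" "\<And>n t. (D n has_real_derivative D (Suc n) t) (at t)"
    using assms by (auto simp: smooth_real_def)
  have "smooth_real (D 1)"
    unfolding smooth_real_def by (rule exI[of _ "\<lambda>n. D (Suc n)"]) (use D in auto)
  then show ?thesis
    using D that by (metis One_nat_def)
qed

text \<open>Recording smoothness as a whole sequence of derivatives pays off here: an antiderivative
  is put in front of the sequence. The radial test functions arise this way.\<close>

lemma smooth_real_antiderivative:
  assumes "smooth_real h" "\<And>t. (G has_real_derivative h t) (at t)"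
  shows "smooth_real G"
proof -
  obtain D where D: "D (0::nat) = h" "\<And>n t. (D n has_real_derivative D (Suc n) t) (at t)"
    using assms(1) by (auto simp: smooth_real_def)
  show ?thesis
    unfolding smooth_real_def
  proof (intro exI conjI allI)
    show "(case_nat G D n has_real_derivative case_nat G D (Suc n) t) (at t)" for n t
      by (cases n) (use D assms(2) in auto)
  qed simp
qed

lemma smooth_real_exp: "smooth_real exp"
  unfolding smooth_real_def by (rule exI[of _ "\<lambda>n. exp"]) (auto intro!: derivative_eq_intros)

text \<open>\<open>Ck\<close> speaks of iterated derivatives, so product and chain rules would have
  to be threaded through its recursion. This class of expressions is closed under directional
  derivatives, and a single induction on the order then suffices.\<close>

inductive smooth_expr :: "('a::euclidean_space \<Rightarrow> real) \<Rightarrow> bool" where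
  linear: "bounded_linear l \<Longrightarrow> smooth_expr l"
| const: "smooth_expr (\<lambda>x. c)"
| add: "smooth_expr f \<Longrightarrow> smooth_expr g \<Longrightarrow> smooth_expr (\<lambda>x. f x + g x)"
| mult: "smooth_expr f \<Longrightarrow> smooth_expr g \<Longrightarrow> smooth_expr (\<lambda>x. f x * g x)"
| comp: "smooth_real h \<Longrightarrow> smooth_expr f \<Longrightarrow> smooth_expr (\<lambda>x. h (f x))"

lemma smooth_expr_derivative:
  "smooth_expr f \<Longrightarrow>
    \<exists>f'. (\<forall>x. (f has_derivative f' x) (at x)) \<and> (\<forall>v. smooth_expr (\<lambda>x. f' x v))"
proof (induction rule: smooth_expr.induct)
  case (linear l)
  then show ?case
    by (intro exI[of _ "\<lambda>x. l"]) (auto intro: bounded_linear_imp_has_derivative smooth_expr.const)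
next
  case (const c)
  then show ?case
    by (intro exI[of _ "\<lambda>x v. 0"]) (auto intro: smooth_expr.const)
next
  case (add f g)
  then obtain f' g' where
    "\<And>x. (f has_derivative f' x) (at x)" "\<And>v. smooth_expr (\<lambda>x. f' x v)"
    "\<And>x. (g has_derivative g' x) (at x)" "\<And>v. smooth_expr (\<lambda>x. g' x v)"
    by blast
  then show ?case
    by (intro exI[of _ "\<lambda>x v. f' x v + g' x v"]) (auto intro: smooth_expr.add has_derivative_add)
next
  case (mult f g)
  then obtain f' g' where
    "\<And>x. (f has_derivative f' x) (at x)" "\<And>v. smooth_expr (\<lambda>x. f' x v)"
    "\<And>x. (g has_derivative g' x) (at x)" "\<And>v. smooth_expr (\<lambda>x. g' x v)"
    by blast
  with mult.hyps show ?case
    by (intro exI[of _ "\<lambda>x v. f x * g' x v + f' x v * g x"])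
      (auto intro!: has_derivative_mult smooth_expr.add
        smooth_expr.mult[of f] smooth_expr.mult[of "\<lambda>x. f' x v" g for v])
next
  case (comp h f)
  then obtain f' where f': "\<And>x. (f has_derivative f' x) (at x)" "\<And>v. smooth_expr (\<lambda>x. f' x v)"
    by blast
  obtain h' where h': "smooth_real h'" "\<And>t. (h has_real_derivative h' t) (at t)"
    using comp.hyps smooth_realE by blast
  have "((\<lambda>x. h (f x)) has_derivative (\<lambda>v. f' x v * h' (f x))) (at x)" for x
    using DERIV_compose_FDERIV[OF h'(2) f'(1)] .
  with f' h' comp.hyps show ?case
    by (intro exI[of _ "\<lambda>x v. f' x v * h' (f x)"]) (auto intro: smooth_expr.intros)
qed

lemma smooth_expr_Ck: "smooth_expr f \<Longrightarrow> Ck k f"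
proof (induction k arbitrary: f)
  case 0
  then obtain f' where "\<forall>x. (f has_derivative f' x) (at x)"
    using smooth_expr_derivative by blast
  then show ?case
    by (auto intro!: continuous_at_imp_continuous_on has_derivative_continuous)
next
  case (Suc k)
  then obtain f' where f': "\<And>x. (f has_derivative f' x) (at x)" "\<And>v. smooth_expr (\<lambda>x. f' x v)"
    using smooth_expr_derivative by blast
  then have "frechet_derivative f (at x) = f' x" for x
    by (metis frechet_derivative_at)
  with f' Suc.IH show ?case
    by (auto simp: differentiable_def)
qed

text \<open>A choice function \<open>d\<close> for derivatives inside the class is iterated to give
  the required sequence. This serves profiles that are built as expressions and must then be
  integrated, antiderivatives being provided for \<open>smooth_real\<close>.\<close>

lemma smooth_real_if_smooth_expr:
  assumes "smooth_expr (f :: real \<Rightarrow> real)"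
  shows "smooth_real f"
proof -
  have "\<exists>g. smooth_expr g \<and> (\<forall>t. (f has_real_derivative g t) (at t))"
    if f: "smooth_expr f" for f :: "real \<Rightarrow> real"
  proof -
    obtain f' where f': "\<And>x. (f has_derivative f' x) (at x)" "\<And>v. smooth_expr (\<lambda>x. f' x v)"
      using smooth_expr_derivative[OF f] by blast
    then have "(f has_real_derivative f' t 1) (at t)" for t
      by (metis has_derivative_bounded_linear has_derivative_imp_has_field_derivative
          linear_scale_real bounded_linear.linear mult.commute mult.right_neutral)
    with f' show ?thesis by blast
  qed
  then obtain d where d: "\<And>f. smooth_expr f \<Longrightarrow> smooth_expr (d f)"
    "\<And>f t. smooth_expr f \<Longrightarrow> (f has_real_derivative d f t) (at t)"
    by metis
  have "smooth_expr ((d ^^ n) f)" for n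
    by (induction n) (auto simp: assms d)
  then show ?thesis
    unfolding smooth_real_def
    by (intro exI[of _ "\<lambda>n. (d ^^ n) f"]) (auto intro: d)
qed

lemma smooth_expr_polynomial: "real_polynomial_function q \<Longrightarrow> smooth_expr q"
  by (induction rule: real_polynomial_function.induct) (auto intro: smooth_expr.intros)

lemma smooth_expr_diff:
  assumes "smooth_expr f" "smooth_expr g"
  shows "smooth_expr (\<lambda>x. f x - g x)"
  using smooth_expr.add[OF assms(1) smooth_expr.mult[OF smooth_expr.const[of "-1"] assms(2)]]
  by simp

lemma smooth_expr_norm_square: "smooth_expr (\<lambda>x::'a::euclidean_space. (norm x)\<^sup>2)"
proof -
  have "smooth_expr (\<lambda>x::'a. \<Sum>b\<in>B. (x \<bullet> b) * (x \<bullet> b))" if "finite B" for B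
    using that
  proof induction
    case (insert b F)
    have "smooth_expr (\<lambda>x::'a. x \<bullet> b)"
      by (intro smooth_expr.linear bounded_linear_inner_left)
    with insert show ?case
      using smooth_expr.add smooth_expr.mult by fastforce
  qed (simp add: smooth_expr.const)
  from this[OF finite_Basis] show ?thesis
    by (simp add: euclidean_inner[symmetric] power2_norm_eq_inner)
qed

text \<open>The classical flat function exp(-1/t), with a polynomial factor in 1/t because its
  derivatives of all orders have this form: differentiating replaces P(z) by z^2 (P(z) - P'(z)),
  where z = 1/t.\<close>

definition flat_exp :: "real poly \<Rightarrow> real \<Rightarrow> real" where
  "flat_exp P t = (if t > 0 then poly P (1 / t) * exp (- 1 / t) else 0)"

text \<open>The extra power of x carries the induction on the polynomial: splitting off the constant
  coefficient moves one factor x into it.\<close>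

lemma tendsto_poly_div_exp_0: "((\<lambda>x::real. x ^ k * poly P x / exp x) \<longlongrightarrow> 0) at_top"
proof (induction P arbitrary: k)
  case (pCons a P)
  have "((\<lambda>x. a * (x ^ k / exp x) + x ^ Suc k * poly P x / exp x) \<longlongrightarrow> a * 0 + 0) at_top"
    by (intro tendsto_intros tendsto_power_div_exp_0 pCons.IH)
  then show ?case
    by (simp add: algebra_simps add_divide_distrib)
qed simp

lemma flat_exp_derivative:
  "(flat_exp P has_real_derivative flat_exp (monom 1 2 * (P - pderiv P)) t) (at t)"
proof -
  consider "t > 0" | "t < 0" | "t = 0" by linarith
  then show ?thesis
  proof cases
    case 1
    have "((\<lambda>t. poly P (1 / t) * exp (- 1 / t)) has_real_derivative
        flat_exp (monom 1 2 * (P - pderiv P)) t) (at t)"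
      unfolding flat_exp_def using 1
      by (auto intro!: derivative_eq_intros DERIV_chain2[OF poly_DERIV]
          simp: poly_monom field_simps power2_eq_square)
    then show ?thesis
      by (rule has_field_derivative_transform_within_open[of _ _ _ "{0<..}"])
        (use 1 in \<open>auto simp: flat_exp_def\<close>)
  next
    case 2
    have "((\<lambda>t. 0) has_real_derivative 0) (at t)" by simp
    then have "(flat_exp P has_real_derivative 0) (at t)"
      by (rule has_field_derivative_transform_within_open[of _ _ _ "{..<0}"])
        (use 2 in \<open>auto simp: flat_exp_def\<close>)
    with 2 show ?thesis by (simp add: flat_exp_def)
  next
    case 3
    \<comment> \<open>With x = 1/h the difference quotient is x P(x) / exp x, the case k = 1 of
      \<open>tendsto_poly_div_exp_0\<close>.\<close>
    have "((\<lambda>h. flat_exp P h / h) \<longlongrightarrow> 0) (at_right 0)"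
    proof -
      have "((\<lambda>h. (inverse h) ^ 1 * poly P (inverse h) / exp (inverse h)) \<longlongrightarrow> 0) (at_right (0::real))"
        by (rule filterlim_compose[OF tendsto_poly_div_exp_0 filterlim_inverse_at_top_right])
      then show ?thesis
        by (rule Lim_transform_eventually)
          (auto simp: eventually_at_right_less flat_exp_def exp_minus field_simps
            intro!: eventually_mono[OF eventually_at_right_less[of 0]])
    qed
    moreover have "((\<lambda>h. flat_exp P h / h) \<longlongrightarrow> 0) (at_left 0)"
      by (rule Lim_transform_eventually[OF tendsto_const])
        (auto simp: flat_exp_def eventually_at_filter)
    ultimately have "((\<lambda>h. flat_exp P h / h) \<longlongrightarrow> 0) (at 0)"
      by (simp add: filterlim_split_at)
    with 3 show ?thesis
      by (simp add: has_field_derivative_iff flat_exp_def)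
  qed
qed

lemma smooth_real_flat_exp: "smooth_real (flat_exp P)"
  unfolding smooth_real_def
proof (intro exI conjI allI)
  show "((\<lambda>n. flat_exp (((\<lambda>P. monom 1 2 * (P - pderiv P)) ^^ n) P)) n has_real_derivative
      (\<lambda>n. flat_exp (((\<lambda>P. monom 1 2 * (P - pderiv P)) ^^ n) P)) (Suc n) t) (at t)" for n t
    using flat_exp_derivative by simp
qed simp

text \<open>Smooth approximations of the indicator of the positive half-line from below. For t > 0
  the subtracted term is the n-th power of a number less than 1, so no quotient or normalising
  integral is needed to force the limit 1.\<close>

definition smooth_step :: "nat \<Rightarrow> real \<Rightarrow> real" where
  "smooth_step n t = 1 - exp (- real n * flat_exp 1 t)"

lemma smooth_expr_smooth_step:
  assumes "smooth_expr f"
  shows "smooth_expr (\<lambda>x. smooth_step n (f x))"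
  unfolding smooth_step_def
  by (intro smooth_expr_diff smooth_expr.const smooth_expr.comp[OF smooth_real_exp]
      smooth_expr.mult smooth_expr.comp[OF smooth_real_flat_exp] assms)

lemma smooth_step_nonpos [simp]: "t \<le> 0 \<Longrightarrow> smooth_step n t = 0"
  by (simp add: smooth_step_def flat_exp_def)

lemma smooth_step_bounds: "0 \<le> smooth_step n t" "smooth_step n t \<le> 1"
  by (auto simp: smooth_step_def flat_exp_def)

lemma smooth_step_tendsto: "(\<lambda>n. smooth_step n t) \<longlonglongrightarrow> indicator {0<..} t"
proof (cases "t > 0")
  case True
  then have "flat_exp 1 t > 0" by (simp add: flat_exp_def)
  then have "(\<lambda>n. 1 - exp (- flat_exp 1 t) ^ n) \<longlonglongrightarrow> 1 - 0"
    by (intro tendsto_intros LIMSEQ_power_zero) simp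
  then have "(\<lambda>n. 1 - exp (- real n * flat_exp 1 t)) \<longlonglongrightarrow> 1 - 0"
    by (simp add: exp_of_nat_mult[symmetric])
  with True show ?thesis by (simp add: smooth_step_def)
qed simp

lemma test_functionsI:
  assumes "smooth_expr \<phi>" "compact K" "K \<subseteq> \<Omega>" "\<And>x. \<phi> x \<noteq> 0 \<Longrightarrow> x \<in> K"
  shows "\<phi> \<in> test_functions \<Omega>"
proof -
  have "closure {x. \<phi> x \<noteq> 0} \<subseteq> K"
    using assms by (intro closure_minimal) (auto intro: compact_imp_closed)
  then show ?thesis
    unfolding test_functions_def
    using assms smooth_expr_Ck compact_Int_closed[OF assms(2) closed_closure[of "{x. \<phi> x \<noteq> 0}"]]
    by (auto simp: Int_absorb1)
qed

subsection \<open>Test functions and weak gradients\<close>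

lemma test_function_Ck: "\<phi> \<in> test_functions \<Omega> \<Longrightarrow> Ck k \<phi>"
  by (simp add: test_functions_def)

lemma test_function_has_derivative:
  assumes "\<phi> \<in> test_functions \<Omega>"
  shows "(\<phi> has_derivative (\<lambda>v. grad \<phi> x \<bullet> v)) (at x)"
proof -
  have "Ck (Suc 0) \<phi>"
    using assms by (rule test_function_Ck)
  then have d: "(\<phi> has_derivative frechet_derivative \<phi> (at x)) (at x)"
    by (simp add: frechet_derivative_works)
  then interpret bounded_linear "frechet_derivative \<phi> (at x)"
    by (rule has_derivative_bounded_linear)
  have "frechet_derivative \<phi> (at x) v = grad \<phi> x \<bullet> v" for v
  proof -
    have "frechet_derivative \<phi> (at x) v =
        frechet_derivative \<phi> (at x) (\<Sum>b\<in>Basis. (v \<bullet> b) *\<^sub>R b)"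
      by (simp add: euclidean_representation)
    also have "\<dots> = grad \<phi> x \<bullet> v"
      unfolding sum scale grad_def inner_sum_left inner_scaleR_left real_scaleR_def
      by (simp add: inner_commute[of v] mult.commute)
    finally show ?thesis .
  qed
  then show ?thesis
    using d by presburger
qed

lemma grad_eqI:
  assumes "(\<phi> has_derivative (\<lambda>v. g \<bullet> v)) (at x)"
  shows "grad \<phi> x = g"
proof -
  have "frechet_derivative \<phi> (at x) = (\<lambda>v. g \<bullet> v)"
    using frechet_derivative_at[OF assms] by simp
  then show ?thesis
    by (simp add: grad_def euclidean_representation)
qed

lemma test_function_continuous:
  assumes "\<phi> \<in> test_functions \<Omega>"
  shows "continuous_on UNIV \<phi>"
  using test_function_Ck[OF assms, of 0] by simp

lemma test_function_continuous_grad: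
  assumes "\<phi> \<in> test_functions \<Omega>"
  shows "continuous_on UNIV (grad \<phi>)"
proof -
  have "Ck (Suc 0) \<phi>"
    using assms by (rule test_function_Ck)
  then show ?thesis
    unfolding grad_def[abs_def] by (intro continuous_intros) simp
qed

lemma test_function_eq_0:
  assumes "\<phi> \<in> test_functions \<Omega>" "x \<notin> \<Omega>"
  shows "\<phi> x = 0" "grad \<phi> x = 0"
proof -
  let ?K = "closure {x. \<phi> x \<noteq> 0}"
  have x: "x \<notin> ?K"
    using assms by (auto simp: test_functions_def)
  then show "\<phi> x = 0"
    using closure_subset[of "{x. \<phi> x \<noteq> 0}"] by auto
  have "((\<lambda>x. 0) has_derivative (\<lambda>v. 0 \<bullet> v)) (at x)"
    by simp
  then have "(\<phi> has_derivative (\<lambda>v. 0 \<bullet> v)) (at x)"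
    by (rule has_derivative_transform_within_open[of _ _ _ _ "- ?K"])
      (use x closure_subset[of "{x. \<phi> x \<noteq> 0}"] in \<open>auto simp: open_Compl\<close>)
  then show "grad \<phi> x = 0"
    by (rule grad_eqI)
qed

lemma bounded_if_continuous_compact_support:
  fixes h :: "'a::metric_space \<Rightarrow> 'b::real_normed_vector"
  assumes "continuous_on UNIV h" "compact K" "\<And>x. x \<notin> K \<Longrightarrow> h x = 0"
  obtains B where "B \<ge> 0" "\<And>x. norm (h x) \<le> B"
proof -
  have "compact (h ` K)"
    using assms by (intro compact_continuous_image) (auto intro: continuous_on_subset)
  then obtain B where "\<forall>y\<in>h ` K. norm y \<le> B"
    using compact_imp_bounded bounded_iff by metis
  with assms(3) have "norm (h x) \<le> max B 0" for x
    by (cases "x \<in> K") (auto simp: le_max_iff_disj)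
  with that[of "max B 0"] show ?thesis by simp
qed

lemma test_function_bounded:
  assumes "\<phi> \<in> test_functions \<Omega>"
  obtains B where "B \<ge> 0" "\<And>x. \<bar>\<phi> x\<bar> \<le> B" "\<And>x. norm (grad \<phi> x) \<le> B"
proof -
  let ?K = "closure {x. \<phi> x \<noteq> 0}"
  \<comment> \<open>A test function is also one on its own support, so it and its gradient both
    vanish off a compact set.\<close>
  have K: "compact ?K" and "\<phi> \<in> test_functions ?K"
    using assms by (auto simp: test_functions_def)
  note zero = test_function_eq_0[OF this(2)]
  obtain B where "B \<ge> 0" "\<And>x. norm (\<phi> x) \<le> B"
    using bounded_if_continuous_compact_support[OF test_function_continuous[OF assms] K zero(1)]
    by blast
  moreover obtain B' where "B' \<ge> 0" "\<And>x. norm (grad \<phi> x) \<le> B'"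
    using bounded_if_continuous_compact_support[OF test_function_continuous_grad[OF assms] K zero(2)]
    by blast
  ultimately show ?thesis
    using that[of "max B B'"] by (simp add: le_max_iff_disj)
qed

text \<open>Uniform approximation on the compact set \<open>S\<close> survives integration against
  an integrable weight: the error is at most e times the L^1 norm of \<psi>. The map
  \<open>T\<close> allows two uses, with the identity on a closed ball and with the squared
  norm.\<close>

lemma integral_eq_0_if_orthogonal_to_polynomials:
  fixes T :: "'a \<Rightarrow> 'b::euclidean_space" and \<psi> :: "'a \<Rightarrow> real"
  assumes \<psi>: "integrable M \<psi>" and T [measurable]: "T \<in> borel_measurable M"
    and S: "compact S" "\<And>x. x \<in> space M \<Longrightarrow> T x \<in> S"
    and poly: "\<And>q. real_polynomial_function q \<Longrightarrow> (\<integral>x. q (T x) * \<psi> x \<partial>M) = 0"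
    and h: "continuous_on S h" "(\<lambda>x. h (T x)) \<in> borel_measurable M"
  shows "(\<integral>x. h (T x) * \<psi> x \<partial>M) = 0"
proof -
  note [measurable] = h(2) borel_measurable_integrable[OF \<psi>]
  have int: "integrable M (\<lambda>x. k (T x) * \<psi> x)"
    if k: "continuous_on S k" and [measurable]: "(\<lambda>x. k (T x)) \<in> borel_measurable M" for k
  proof -
    have "compact (k ` S)"
      using k S(1) by (rule compact_continuous_image)
    then obtain B where B: "\<forall>y\<in>k ` S. norm y \<le> B"
      using compact_imp_bounded bounded_iff by metis
    show ?thesis
    proof (rule Bochner_Integration.integrable_bound[OF integrable_mult_right[OF \<psi>, of B]])
      have "\<bar>k (T x) * \<psi> x\<bar> \<le> \<bar>B * \<psi> x\<bar>" if "x \<in> space M" for x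
        using B S(2)[OF that] by (simp add: abs_mult mult_right_mono order_trans[OF _ abs_ge_self])
      then show "AE x in M. norm (k (T x) * \<psi> x) \<le> norm (B * \<psi> x)"
        by (intro AE_I2) simp
    qed simp
  qed
  have le: "\<bar>\<integral>x. h (T x) * \<psi> x \<partial>M\<bar> \<le> e * (\<integral>x. \<bar>\<psi> x\<bar> \<partial>M)" if e: "e > 0" for e
  proof -
    obtain q where q: "real_polynomial_function q" "\<And>y. y \<in> S \<Longrightarrow> \<bar>h y - q y\<bar> < e"
      using Stone_Weierstrass_real_polynomial_function[OF S(1) h(1) e] by metis
    have cq: "continuous_on UNIV q"
      using q(1) by (simp add: continuous_on_polymonial_function real_polynomial_function_eq)
    then have [measurable]: "q \<in> borel_measurable borel"
      by (rule borel_measurable_continuous_onI)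
    have intq: "integrable M (\<lambda>x. q (T x) * \<psi> x)"
      using cq by (intro int) (blast intro: continuous_on_subset, measurable)
    have "(\<integral>x. h (T x) * \<psi> x \<partial>M) = (\<integral>x. (h (T x) - q (T x)) * \<psi> x \<partial>M)"
      using poly[OF q(1)] intq int[OF h] by (simp add: left_diff_distrib)
    also have "\<bar>\<dots>\<bar> \<le> (\<integral>x. e * \<bar>\<psi> x\<bar> \<partial>M)"
    proof (rule order_trans[OF integral_abs_bound integral_mono])
      show "integrable M (\<lambda>x. \<bar>(h (T x) - q (T x)) * \<psi> x\<bar>)"
        using intq int[OF h] by (simp add: left_diff_distrib)
      show "\<bar>(h (T x) - q (T x)) * \<psi> x\<bar> \<le> e * \<bar>\<psi> x\<bar>" if "x \<in> space M" for x
        using less_imp_le[OF q(2)[OF S(2)[OF that]]] by (simp add: abs_mult mult_right_mono)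
    qed (use \<psi> in simp)
    finally show ?thesis by simp
  qed
  have "((\<lambda>e. e * (\<integral>x. \<bar>\<psi> x\<bar> \<partial>M)) \<longlongrightarrow> 0 * (\<integral>x. \<bar>\<psi> x\<bar> \<partial>M)) (at_right 0)"
    by (intro tendsto_intros)
  then have "\<bar>\<integral>x. h (T x) * \<psi> x \<partial>M\<bar> \<le> 0 * (\<integral>x. \<bar>\<psi> x\<bar> \<partial>M)"
    by (rule tendsto_lowerbound)
      (use le eventually_at_right_less[of "0::real"] in \<open>auto elim: eventually_mono\<close>)
  then show ?thesis by simp
qed

text \<open>Orthogonality is enlarged in three stages: from test functions to polynomials on the
  ball through cutoffs, to continuous functions by Stone-Weierstrass, and to the sign of \<psi> by
  bounded a.e. convergence, where it says that the integral of |\<psi>| over the ball is 0.\<close>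

lemma AE_ball_eq_0_if_orthogonal_to_test_functions:
  fixes \<psi> :: "'a::euclidean_space \<Rightarrow> real"
  assumes r: "r > 0" "cball c r \<subseteq> \<Omega>" and \<Omega>: "open \<Omega>"
    and \<psi>: "\<psi> absolutely_integrable_on cball c r"
    and orth: "\<And>\<phi>. \<phi> \<in> test_functions \<Omega> \<Longrightarrow> (\<integral>x. \<phi> x * \<psi> x \<partial>lebesgue_on \<Omega>) = 0"
  shows "AE x in lebesgue. x \<in> ball c r \<longrightarrow> \<psi> x = 0"
proof -
  define M where "M = lebesgue_on (cball c r)"
  \<comment> \<open>The cutoffs used below vanish off the open ball and tend to 1 inside it, so
    their limit tests this truncation.\<close>
  define \<psi>' where "\<psi>' = (\<lambda>x. indicator (ball c r) x * \<psi> x)"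
  have [measurable]: "ball c r \<in> sets M"
    unfolding M_def by (auto simp: sets_restrict_space_iff)
  have space: "space M = cball c r"
    by (simp add: M_def)
  have int_M: "(\<integral>x. f x \<partial>M) = (\<integral>x. indicator (cball c r) x * f x \<partial>lebesgue)" for f :: "'a \<Rightarrow> real"
    unfolding M_def by (subst integral_restrict_space) auto
  have \<psi>_M: "integrable M \<psi>"
    using \<psi> unfolding M_def set_integrable_def by (subst integrable_restrict_space) auto
  note [measurable] = borel_measurable_integrable[OF \<psi>_M]
  have meas: "f \<in> borel_measurable M" if "continuous_on UNIV f" for f :: "'a \<Rightarrow> real"
    unfolding M_def using that
    by (intro continuous_imp_measurable_on_sets_lebesgue) (auto intro: continuous_on_subset)
  have \<psi>'_M: "integrable M \<psi>'"
  proof (rule Bochner_Integration.integrable_bound[OF \<psi>_M])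
    show "\<psi>' \<in> borel_measurable M"
      unfolding \<psi>'_def by measurable
  qed (auto simp: \<psi>'_def indicator_def)
  note [measurable] = borel_measurable_integrable[OF this]
  \<comment> \<open>The squared distance is a polynomial, hence smooth at the centre as
    well.\<close>
  have smooth_dist: "smooth_expr (\<lambda>x. r\<^sup>2 - (norm (x - c))\<^sup>2)"
  proof -
    have "smooth_expr (\<lambda>x. (r\<^sup>2 - (norm c)\<^sup>2 + x \<bullet> (2 *\<^sub>R c)) - (norm x)\<^sup>2)"
      by (intro smooth_expr_diff smooth_expr.add smooth_expr.const smooth_expr_norm_square
          smooth_expr.linear bounded_linear_inner_left)
    then show ?thesis
      by (simp add: power2_norm_eq_inner algebra_simps inner_commute)
  qed
  have poly: "(\<integral>x. q x * \<psi>' x \<partial>M) = 0" if q: "real_polynomial_function q" for q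
  proof -
    have cq: "continuous_on UNIV q"
      using q by (simp add: continuous_on_polymonial_function real_polynomial_function_eq)
    note [measurable] = meas[OF cq]
    have "bounded (q ` cball c r)"
      using cq by (intro compact_imp_bounded compact_continuous_image)
        (auto intro: continuous_on_subset)
    then obtain B where B: "\<And>x. x \<in> cball c r \<Longrightarrow> \<bar>q x\<bar> \<le> B"
      by (metis bounded_iff imageI real_norm_def)
    define \<phi> where "\<phi> = (\<lambda>n x. q x * smooth_step n (r\<^sup>2 - (norm (x - c))\<^sup>2))"
    have \<phi>: "\<phi> n \<in> test_functions \<Omega>" for n
    proof (rule test_functionsI[OF _ compact_cball r(2)])
      show "smooth_expr (\<phi> n)"
        unfolding \<phi>_def
        by (intro smooth_expr.mult[OF smooth_expr_polynomial[OF q]] smooth_expr_smooth_step smooth_dist)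
      show "x \<in> cball c r" if "\<phi> n x \<noteq> 0" for x
      proof (rule ccontr)
        assume "x \<notin> cball c r"
        then have "r\<^sup>2 \<le> (norm (x - c))\<^sup>2"
          using r(1) by (intro power_mono) (auto simp: dist_norm norm_minus_commute)
        then show False
          using that by (simp add: \<phi>_def)
      qed
    qed
    have "(\<integral>x. \<phi> n x * \<psi> x \<partial>M) = 0" for n
    proof -
      have zero: "\<phi> n x = 0" if "x \<notin> cball c r" for x
      proof -
        have "r\<^sup>2 \<le> (norm (x - c))\<^sup>2"
          using r(1) that by (intro power_mono) (auto simp: dist_norm norm_minus_commute)
        then show ?thesis
          by (simp add: \<phi>_def)
      qed
      have "(\<integral>x. \<phi> n x * \<psi> x \<partial>M) = (\<integral>x. \<phi> n x * \<psi> x \<partial>lebesgue_on \<Omega>)"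
        unfolding int_M using \<Omega> zero subsetD[OF r(2), unfolded mem_cball]
        by (subst integral_restrict_space)
          (auto intro!: Bochner_Integration.integral_cong simp: indicator_def)
      with orth[OF \<phi>] show ?thesis by simp
    qed
    moreover have "(\<lambda>n. \<integral>x. \<phi> n x * \<psi> x \<partial>M) \<longlonglongrightarrow> (\<integral>x. q x * \<psi>' x \<partial>M)"
    proof (rule integral_dominated_convergence)
      show "integrable M (\<lambda>x. B * \<bar>\<psi> x\<bar>)"
        using \<psi>_M by simp
      show "(\<lambda>x. \<phi> n x * \<psi> x) \<in> borel_measurable M" for n
        using meas[OF test_function_continuous[OF \<phi>]] by measurable
      have "(\<lambda>n. \<phi> n x * \<psi> x) \<longlonglongrightarrow> q x * indicator {0<..} (r\<^sup>2 - (norm (x - c))\<^sup>2) * \<psi> x" for x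
        unfolding \<phi>_def by (intro tendsto_intros smooth_step_tendsto)
      moreover have "indicator {0<..} (r\<^sup>2 - (norm (x - c))\<^sup>2) = indicat_real (ball c r) x" for x
        using r(1) power2_less_imp_less[of "norm (x - c)" r] power_strict_mono[of "norm (x - c)" r 2]
        by (auto simp: indicator_def dist_norm norm_minus_commute)
      ultimately show "AE x in M. (\<lambda>n. \<phi> n x * \<psi> x) \<longlonglongrightarrow> q x * \<psi>' x"
        by (simp add: \<psi>'_def mult.assoc)
      show "AE x in M. norm (\<phi> n x * \<psi> x) \<le> B * \<bar>\<psi> x\<bar>" for n
      proof (rule AE_I2)
        fix x assume "x \<in> space M"
        then have "\<bar>q x\<bar> * \<bar>smooth_step n (r\<^sup>2 - (norm (x - c))\<^sup>2)\<bar> \<le> B * 1"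
          using B[of x] smooth_step_bounds[of n] by (intro mult_mono) (auto simp: space)
        then show "norm (\<phi> n x * \<psi> x) \<le> B * \<bar>\<psi> x\<bar>"
          by (simp add: \<phi>_def abs_mult mult_right_mono)
      qed
    qed (use \<psi>'_def in measurable)
    ultimately show ?thesis
      by (simp add: LIMSEQ_const_iff)
  qed
  have cont: "(\<integral>x. h x * \<psi>' x \<partial>M) = 0" if "continuous_on UNIV h" for h
  proof (rule integral_eq_0_if_orthogonal_to_polynomials[where T="\<lambda>x. x" and S="cball c r"])
    show "(\<lambda>x. x) \<in> borel_measurable M"
      unfolding M_def by (intro measurable_restrict_space1 measurable_completion) simp
    show "continuous_on (cball c r) h"
      using that by (rule continuous_on_subset) simp
  qed (use \<psi>'_M poly meas[OF that] in \<open>auto simp: space\<close>)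
  \<comment> \<open>A measurable function is an a.e. limit of continuous ones, and here the function
    is the sign of \<open>\<psi>'\<close>.\<close>
  have "(\<lambda>x. sgn (indicator (ball c r) x * (indicator (cball c r) x *\<^sub>R \<psi> x))) measurable_on UNIV"
    using borel_measurable_integrable[OF \<psi>[unfolded set_integrable_def]]
    by (intro lebesgue_measurable_imp_measurable_on borel_measurable_times
        borel_measurable_indicator measurable_compose[OF _ borel_measurable_sgn]) auto
  then obtain N g where N: "negligible N" and g: "\<And>n. continuous_on UNIV (g n)"
    and lim: "\<And>x. x \<notin> N \<Longrightarrow>
      (\<lambda>n. g n x) \<longlonglongrightarrow> sgn (indicator (ball c r) x * (indicator (cball c r) x *\<^sub>R \<psi> x))"
    unfolding measurable_on_def by auto
  \<comment> \<open>Clipping to [-1, 1] keeps the limit, since a sign lies in that interval, and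
    makes |\<psi>'| a dominating function.\<close>
  define g' where "g' = (\<lambda>n::nat. \<lambda>x. max (-1) (min 1 (g n x)))"
  have cg': "continuous_on UNIV (g' n)" for n
    unfolding g'_def by (intro continuous_intros g)
  have "(\<lambda>n. \<integral>x. g' n x * \<psi>' x \<partial>M) \<longlonglongrightarrow> (\<integral>x. \<bar>\<psi>' x\<bar> \<partial>M)"
  proof (rule integral_dominated_convergence)
    show "integrable M (\<lambda>x. \<bar>\<psi>' x\<bar>)"
      using \<psi>'_M by simp
    show "(\<lambda>x. g' n x * \<psi>' x) \<in> borel_measurable M" for n
      using meas[OF cg'] by measurable
    show "AE x in M. norm (g' n x * \<psi>' x) \<le> \<bar>\<psi>' x\<bar>" for n
      by (intro AE_I2) (auto simp: g'_def abs_mult mult_left_le_one_le)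
    have "AE x in lebesgue. x \<notin> N"
      using N negligible_iff_null_sets AE_not_in by blast
    then have "AE x in lebesgue. x \<in> cball c r \<longrightarrow> (\<lambda>n. g' n x * \<psi>' x) \<longlonglongrightarrow> \<bar>\<psi>' x\<bar>"
    proof eventually_elim
      case (elim x)
      have "(\<lambda>n. g' n x * \<psi>' x) \<longlonglongrightarrow> max (-1) (min 1 (sgn (\<psi>' x))) * \<psi>' x" if "x \<in> cball c r"
        unfolding g'_def using lim[OF elim] that
        by (intro tendsto_intros) (simp add: \<psi>'_def)
      moreover have "max (-1) (min 1 (sgn (\<psi>' x))) * \<psi>' x = \<bar>\<psi>' x\<bar>"
        by (auto simp: sgn_if)
      ultimately show ?case by simp
    qed
    then show "AE x in M. (\<lambda>n. g' n x * \<psi>' x) \<longlonglongrightarrow> \<bar>\<psi>' x\<bar>"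
      unfolding M_def by (subst AE_restrict_space_iff) auto
  qed measurable
  then have "(\<integral>x. \<bar>\<psi>' x\<bar> \<partial>M) = 0"
    by (simp add: cont[OF cg'] LIMSEQ_const_iff)
  then have "AE x in M. \<psi>' x = 0"
    using \<psi>'_M by (subst (asm) integral_nonneg_eq_0_iff_AE) auto
  then show ?thesis
    unfolding M_def by (subst (asm) AE_restrict_space_iff) (auto simp: \<psi>'_def elim!: eventually_mono)
qed

text \<open>By Lindelof, countably many balls with closure in \<Omega> already cover it, so the
  exceptional sets of the local version unite to a null set.\<close>

lemma AE_eq_0_if_orthogonal_to_test_functions:
  fixes \<psi> :: "'a::euclidean_space \<Rightarrow> real"
  assumes \<Omega>: "open \<Omega>" and \<psi>: "\<psi> locally_integrable_on \<Omega>"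
    and orth: "\<And>\<phi>. \<phi> \<in> test_functions \<Omega> \<Longrightarrow> (\<integral>x. \<phi> x * \<psi> x \<partial>lebesgue_on \<Omega>) = 0"
  shows "AE x in lebesgue_on \<Omega>. \<psi> x = 0"
proof -
  define \<F> where "\<F> = {ball c r |c r. r > 0 \<and> cball c r \<subseteq> \<Omega>}"
  obtain \<F>' where \<F>': "\<F>' \<subseteq> \<F>" "countable \<F>'" "\<Union>\<F>' = \<Union>\<F>"
    by (rule Lindelof_openin[of \<F> UNIV]) (auto simp: \<F>_def)
  have "AE x in lebesgue. \<forall>B\<in>\<F>'. x \<in> B \<longrightarrow> \<psi> x = 0"
  proof (subst AE_ball_countable[OF \<F>'(2)], intro ballI)
    fix B assume "B \<in> \<F>'"
    then obtain c r where "B = ball c r" "r > 0" "cball c r \<subseteq> \<Omega>"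
      using \<F>'(1) by (auto simp: \<F>_def)
    with AE_ball_eq_0_if_orthogonal_to_test_functions[OF this(2,3) \<Omega> _ orth] \<psi>
    show "AE x in lebesgue. x \<in> B \<longrightarrow> \<psi> x = 0"
      by (simp add: locally_integrable_on_def)
  qed
  moreover have "\<Omega> \<subseteq> \<Union>\<F>'"
    unfolding \<F>'(3)
  proof
    fix x assume "x \<in> \<Omega>"
    then obtain r where "r > 0" "cball x r \<subseteq> \<Omega>"
      using \<Omega> open_contains_cball by blast
    then show "x \<in> \<Union>\<F>"
      by (auto simp: \<F>_def intro!: exI[of _ "ball x r"])
  qed
  ultimately show ?thesis
    using \<Omega> by (subst AE_restrict_space_iff) (auto elim!: eventually_mono)
qed

text \<open>Needed to identify two representatives that come from different sources: the gradient in
  the equation and the limit of gradients in the definition of the space with zero boundary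
  values.\<close>

lemma weak_gradient_unique:
  assumes "open \<Omega>" "has_weak_gradient \<Omega> u Du" "has_weak_gradient \<Omega> u Du'"
  shows "AE x in lebesgue_on \<Omega>. Du x = Du' x"
proof -
  \<comment> \<open>The Bochner integral is linear only on integrable functions. The compact support
    of \<phi> reduces integrability to the local integrability of \<open>E\<close>.\<close>
  have int: "integrable (lebesgue_on \<Omega>) (\<lambda>x. \<phi> x *\<^sub>R E x)"
    if \<phi>: "\<phi> \<in> test_functions \<Omega>" and E: "E locally_integrable_on \<Omega>" for \<phi> and E :: "'a \<Rightarrow> 'a"
  proof -
    let ?K = "closure {x. \<phi> x \<noteq> 0}"
    have K: "compact ?K" "?K \<subseteq> \<Omega>" and \<phi>_K: "\<phi> \<in> test_functions ?K"
      using \<phi> by (auto simp: test_functions_def)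
    obtain B where B: "\<And>x. \<bar>\<phi> x\<bar> \<le> B"
      using test_function_bounded[OF \<phi>] by metis
    have E_K: "integrable lebesgue (\<lambda>x. indicator ?K x *\<^sub>R E x)"
      using E K by (auto simp: locally_integrable_on_def set_integrable_def)
    have [measurable]: "\<phi> \<in> borel_measurable lebesgue"
      using borel_measurable_continuous_onI[OF test_function_continuous[OF \<phi>]]
      by (simp add: measurable_completion)
    note [measurable] = borel_measurable_integrable[OF E_K]
    have "integrable lebesgue (\<lambda>x. \<phi> x *\<^sub>R (indicator ?K x *\<^sub>R E x))"
    proof (rule Bochner_Integration.integrable_bound)
      show "integrable lebesgue (\<lambda>x. B *\<^sub>R (indicator ?K x *\<^sub>R E x))"
        using E_K by (rule integrable_scaleR_right)
      show "AE x in lebesgue. norm (\<phi> x *\<^sub>R (indicator ?K x *\<^sub>R E x))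
          \<le> norm (B *\<^sub>R (indicator ?K x *\<^sub>R E x))"
        using order_trans[OF B abs_ge_self]
        by (intro AE_I2) (simp add: abs_mult mult_right_mono)
    qed measurable
    also have "(\<lambda>x. \<phi> x *\<^sub>R (indicator ?K x *\<^sub>R E x)) = (\<lambda>x. indicator \<Omega> x *\<^sub>R (\<phi> x *\<^sub>R E x))"
    proof
      show "\<phi> x *\<^sub>R (indicator ?K x *\<^sub>R E x) = indicator \<Omega> x *\<^sub>R (\<phi> x *\<^sub>R E x)" for x
        using K(2) test_function_eq_0(1)[OF \<phi>_K, of x]
        by (cases "x \<in> ?K"; cases "x \<in> \<Omega>") auto
    qed
    finally show ?thesis
      using assms(1) by (subst integrable_restrict_space) auto
  qed
  have "AE x in lebesgue_on \<Omega>. (Du x - Du' x) \<bullet> b = 0" for b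
  proof (rule AE_eq_0_if_orthogonal_to_test_functions[OF assms(1)])
    show "(\<lambda>x. (Du x - Du' x) \<bullet> b) locally_integrable_on \<Omega>"
      using assms(2,3) unfolding has_weak_gradient_def locally_integrable_on_def set_integrable_def
      by (auto simp: inner_diff_left right_diff_distrib inner_scaleR_left[symmetric]
          simp del: inner_scaleR_left intro!: Bochner_Integration.integrable_diff integrable_inner_left)
    fix \<phi> assume \<phi>: "\<phi> \<in> test_functions \<Omega>"
    have int_Du: "integrable (lebesgue_on \<Omega>) (\<lambda>x. \<phi> x *\<^sub>R Du x)"
      "integrable (lebesgue_on \<Omega>) (\<lambda>x. \<phi> x *\<^sub>R Du' x)"
      using assms(2,3) by (auto simp: has_weak_gradient_def intro!: int \<phi>)
    have "(\<integral>x. \<phi> x *\<^sub>R Du x \<partial>lebesgue_on \<Omega>) = (\<integral>x. \<phi> x *\<^sub>R Du' x \<partial>lebesgue_on \<Omega>)"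
      using assms(2,3) \<phi> unfolding has_weak_gradient_def by (metis neg_equal_iff_equal)
    with int_Du have "(\<integral>x. \<phi> x *\<^sub>R Du x - \<phi> x *\<^sub>R Du' x \<partial>lebesgue_on \<Omega>) \<bullet> b = 0"
      by simp
    then have "(\<integral>x. (\<phi> x *\<^sub>R Du x - \<phi> x *\<^sub>R Du' x) \<bullet> b \<partial>lebesgue_on \<Omega>) = 0"
      using int_Du by (subst integral_inner_left) auto
    then show "(\<integral>x. \<phi> x * ((Du x - Du' x) \<bullet> b) \<partial>lebesgue_on \<Omega>) = 0"
      by (simp add: scaleR_diff_right[symmetric])
  qed
  then have "AE x in lebesgue_on \<Omega>. \<forall>b\<in>Basis. (Du x - Du' x) \<bullet> b = 0"
    by (subst AE_ball_countable) (auto intro: countable_finite)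
  then show ?thesis
    by eventually_elim (rule euclidean_eqI, simp add: inner_diff_left)
qed

subsection \<open>Monotonicity\<close>

lemma H_eq: "H \<alpha> \<xi> = (max 0 (norm \<xi> - 1) powr \<alpha> / norm \<xi>) *\<^sub>R \<xi>"
  by (simp add: H_def divide_inverse)

lemma powr_diff_mult_diff_nonneg:
  fixes x y q :: real
  assumes "0 < q" "0 \<le> x" "0 \<le> y"
  shows "0 \<le> (x powr q - y powr q) * (x - y)"
    and "(x powr q - y powr q) * (x - y) = 0 \<Longrightarrow> x = y"
  using assms powr_less_mono2[of q x y] powr_less_mono2[of q y x]
  by (cases x y rule: linorder_cases; auto simp: zero_le_mult_iff)+

text \<open>With \<open>h\<close> the length of \<^term>\<open>H (p - 1) \<xi>\<close>, the inner product splits as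
  \<open>(h - b\<^sup>p\<^sup>-\<^sup>1) (\<bar>\<xi>\<bar> - 1 - b) + (h (1 + b) / \<bar>\<xi>\<bar> + b\<^sup>p\<^sup>-\<^sup>1) (\<bar>\<xi>\<bar> - \<xi> \<bullet> e)\<close>, with both terms nonnegative.\<close>

lemma H_monotone:
  fixes \<xi> e :: "'a::euclidean_space"
  assumes p: "p > 1" and b: "b \<ge> 0" and e: "norm e = 1"
  shows "0 \<le> (H (p - 1) \<xi> - (b powr (p - 1)) *\<^sub>R e) \<bullet> (\<xi> - (1 + b) *\<^sub>R e)" (is "0 \<le> ?I")
    and "(H (p - 1) \<xi> - (b powr (p - 1)) *\<^sub>R e) \<bullet> (\<xi> - (1 + b) *\<^sub>R e) = 0 \<Longrightarrow> H 1 \<xi> = b *\<^sub>R e"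
proof -
  define \<rho> h a where "\<rho> = norm \<xi>" and "h = max 0 (\<rho> - 1) powr (p - 1)" and "a = b powr (p - 1)"
  have \<rho>: "\<rho> \<ge> 0" and h: "h \<ge> 0" and a: "a \<ge> 0"
    by (auto simp: \<rho>_def h_def a_def)
  have le: "\<xi> \<bullet> e \<le> \<rho>"
    using norm_cauchy_schwarz[of \<xi> e] e by (simp add: \<rho>_def)
  have ee: "e \<bullet> e = 1"
    using e by (simp add: power2_norm_eq_inner[symmetric])
  have \<xi>\<xi>: "\<xi> \<bullet> \<xi> = \<rho> * \<rho>"
    by (simp add: \<rho>_def power2_norm_eq_inner[symmetric] power2_eq_square)
  have "?I = ((h / \<rho>) *\<^sub>R \<xi> - a *\<^sub>R e) \<bullet> (\<xi> - (1 + b) *\<^sub>R e)"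
    by (simp add: H_eq h_def a_def \<rho>_def)
  also have "\<dots> = h / \<rho> * (\<rho> * \<rho>) - h / \<rho> * (1 + b) * (\<xi> \<bullet> e) - a * (\<xi> \<bullet> e) + a * (1 + b)"
    by (simp add: inner_diff_left inner_diff_right \<xi>\<xi> ee inner_commute[of e \<xi>]
        algebra_simps add_divide_distrib)
  also have "\<dots> = (h - a) * (\<rho> - (1 + b)) + (h / \<rho> * (1 + b) + a) * (\<rho> - \<xi> \<bullet> e)"
  proof (cases "\<rho> = 0")
    \<comment> \<open>At \<xi> = 0 the quotient h / \<rho> is 0 by convention, and h = 0 as well, so
      the splitting persists.\<close>
    case True
    then show ?thesis
      using p by (simp add: h_def \<rho>_def algebra_simps)
  qed (simp add: field_simps)
  finally have I: "?I = (h - a) * (\<rho> - (1 + b)) + (h / \<rho> * (1 + b) + a) * (\<rho> - \<xi> \<bullet> e)" .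
  have 1: "0 \<le> (h - a) * (\<rho> - (1 + b))"
  proof (cases "\<rho> \<ge> 1")
    case True
    then show ?thesis
      using powr_diff_mult_diff_nonneg(1)[of "p - 1" "\<rho> - 1" b] p b by (simp add: h_def a_def algebra_simps)
  next
    case False
    then show ?thesis
      using a b p by (simp add: h_def mult_nonneg_nonpos)
  qed
  have 2: "0 \<le> (h / \<rho> * (1 + b) + a) * (\<rho> - \<xi> \<bullet> e)"
    using h \<rho> a b le by (intro mult_nonneg_nonneg add_nonneg_nonneg divide_nonneg_nonneg) auto
  show "0 \<le> ?I"
    using I 1 2 by simp
  assume "?I = 0"
  then have eq: "(h - a) * (\<rho> - (1 + b)) = 0" "(h / \<rho> * (1 + b) + a) * (\<rho> - \<xi> \<bullet> e) = 0"
    using I 1 2 by linarith+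
  show "H 1 \<xi> = b *\<^sub>R e"
  proof (cases "b = 0")
    \<comment> \<open>The degenerate case: a = 0, and the first product only yields |\<xi>| <= 1.
      The direction of \<xi> stays free, but \<open>H 1\<close> vanishes there.\<close>
    case True
    then have "max 0 (\<rho> - 1) = 0"
      using eq(1) p by (auto simp: a_def h_def)
    then show ?thesis
      using True by (simp add: H_eq \<rho>_def)
  next
    case False
    then have "a > 0"
      using b by (simp add: a_def)
    \<comment> \<open>The coefficient of the second product is positive because a > 0. This is
      equality in Cauchy-Schwarz, so \<xi> is a multiple of e, and the first product then fixes its
      length.\<close>
    then have "\<xi> \<bullet> e = \<rho>"
      using eq(2) h \<rho> b by (auto simp: add_nonneg_eq_0_iff)
    then have "norm (\<xi> - \<rho> *\<^sub>R e) ^ 2 = 0"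
      unfolding power2_norm_eq_inner
      by (simp add: inner_diff_left inner_diff_right \<xi>\<xi> ee inner_commute[of e \<xi>])
    then have \<xi>: "\<xi> = \<rho> *\<^sub>R e"
      by simp
    have "\<rho> - 1 = b"
    proof (cases "\<rho> \<ge> 1")
      case True
      then show ?thesis
        using powr_diff_mult_diff_nonneg(2)[of "p - 1" "\<rho> - 1" b] p b eq(1)
        by (simp add: h_def a_def algebra_simps)
    next
      case False
      then show ?thesis
        using eq(1) \<open>a > 0\<close> b p by (simp add: h_def)
    qed
    then have "H 1 \<xi> = (b / \<rho>) *\<^sub>R \<xi>" and "\<rho> \<noteq> 0"
      using b by (auto simp: H_eq \<rho>_def[symmetric])
    then show ?thesis
      by (subst (asm) (2) \<xi>) simp
  qed
qed

subsection \<open>Rearrangement of radial functions\<close>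

lemma emeasure_ball_0:
  assumes "r \<ge> 0"
  shows "emeasure lebesgue (ball (0::'a::euclidean_space) r) =
    ennreal (measure lebesgue (ball (0::'a) 1) * r ^ DIM('a))"
  using assms emeasure_ball[of r "0::'a"] content_ball[of 1 "0::'a"] by simp

lemma emeasure_cball_0:
  assumes "r \<ge> 0"
  shows "emeasure lebesgue (cball (0::'a::euclidean_space) r) =
    ennreal (measure lebesgue (ball (0::'a) 1) * r ^ DIM('a))"
  using assms emeasure_cball[of r "0::'a"] content_ball[of 1 "0::'a"] by simp

lemma borel_measurable_if_antimono_on_halfline:
  fixes g :: "real \<Rightarrow> real"
  assumes "antimono_on {0<..} g" "\<And>t. t \<le> 0 \<Longrightarrow> g t = 0"
  shows "g \<in> borel_measurable borel"
proof -
  have "mono_on {0<..} (\<lambda>t. - g t)"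
    using assms(1) by (auto simp: monotone_on_def)
  then have "(\<lambda>t. - g t) \<in> borel_measurable (restrict_space borel {0<..})"
    by (rule borel_measurable_mono_on_fnc)
  then have "g \<in> borel_measurable (restrict_space borel {0<..})"
    by (simp add: borel_measurable_uminus_eq)
  then have "(\<lambda>t. indicator {0<..} t *\<^sub>R g t) \<in> borel_measurable borel"
    by (subst borel_measurable_restrict_space_iff[symmetric]) auto
  also have "(\<lambda>t. indicator {0<..} t *\<^sub>R g t) = g"
    using assms(2) by (auto simp: indicator_def fun_eq_iff)
  finally show ?thesis .
qed

lemma countable_discontinuities_antimono_on:
  fixes g :: "real \<Rightarrow> real"
  assumes "antimono_on A g" "open A"
  shows "countable {t\<in>A. \<not> isCont g t}"
proof -
  have "countable {t\<in>A. \<not> isCont (\<lambda>t. - g t) t}"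
    using assms by (intro mono_on_ctble_discont_open) (auto simp: monotone_on_def)
  moreover have "isCont (\<lambda>t. - g t) t \<longleftrightarrow> isCont g t" for t
    using continuous_minus[of "at t" "\<lambda>t. - g t"] by (auto intro: continuous_minus)
  ultimately show ?thesis by simp
qed

context
  fixes R :: real and f :: "'a::euclidean_space \<Rightarrow> real" and g :: "real \<Rightarrow> real"
  assumes f: "f \<in> borel_measurable (lebesgue_on (ball 0 R))"
    and f_eq: "AE x in lebesgue_on (ball 0 R). f x = g (norm x)"
    and g: "antimono_on {0<..} g" "\<And>t. 0 \<le> g t" "\<And>t. t \<le> 0 \<Longrightarrow> g t = 0"
begin

lemma radial_superlevel_set_measurable: "{x\<in>ball (0::'a) R. g (norm x) > \<tau>} \<in> sets lebesgue"
proof -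
  note [measurable] = borel_measurable_if_antimono_on_halfline[OF g(1,3)]
  have "{x\<in>space lborel. norm (x::'a) < R \<and> g (norm x) > \<tau>} \<in> sets lborel"
    by measurable
  then show ?thesis
    by (intro sets_completionI_sets) simp
qed

lemma distr_fun_radial:
  "distr_fun (ball 0 R) f \<tau> = emeasure lebesgue {x\<in>ball (0::'a) R. g (norm x) > \<tau>}"
proof -
  have "distr_fun (ball 0 R) f \<tau> =
      emeasure (lebesgue_on (ball 0 R)) {x\<in>ball (0::'a) R. g (norm x) > \<tau>}"
    unfolding distr_fun_def
  proof (rule emeasure_eq_AE)
    show "AE x in lebesgue_on (ball 0 R).
        (x \<in> {x\<in>ball 0 R. \<bar>f x\<bar> > \<tau>}) = (x \<in> {x\<in>ball 0 R. g (norm x) > \<tau>})"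
      using f_eq by eventually_elim (simp add: g(2))
    note [measurable] = f
    have "{x\<in>space (lebesgue_on (ball 0 R)). \<bar>f x\<bar> > \<tau>} \<in> sets (lebesgue_on (ball 0 R))"
      by measurable
    then show "{x\<in>ball 0 R. \<bar>f x\<bar> > \<tau>} \<in> sets (lebesgue_on (ball 0 R))"
      by simp
    show "{x\<in>ball (0::'a) R. g (norm x) > \<tau>} \<in> sets (lebesgue_on (ball 0 R))"
      using radial_superlevel_set_measurable by (subst sets_restrict_space_iff) auto
  qed
  then show ?thesis
    by (subst (asm) emeasure_restrict_space) auto
qed

text \<open>The level g(\<sigma>) is admissible in the infimum: since g decreases, the set where it
  exceeds g(\<sigma>) lies in the closed ball of radius \<sigma>.\<close>

lemma rearr_radial_le:
  assumes "\<sigma> > 0"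
  shows "rearr (ball 0 R) f (measure lebesgue (ball (0::'a) 1) * \<sigma> ^ DIM('a)) \<le> ennreal (g \<sigma>)"
  unfolding rearr_def
proof (rule INF_lower, safe)
  have "norm x \<le> \<sigma>" if "g (norm x) > g \<sigma>" for x :: 'a
    using that monotone_onD[OF g(1), of \<sigma> "norm x"] assms by fastforce
  then have "distr_fun (ball 0 R) f (g \<sigma>) \<le> emeasure lebesgue (cball (0::'a) \<sigma>)"
    unfolding distr_fun_radial by (intro emeasure_mono) auto
  then show "distr_fun (ball 0 R) f (g \<sigma>)
      \<le> ennreal (measure lebesgue (ball (0::'a) 1) * \<sigma> ^ DIM('a))"
    using assms emeasure_cball_0[of \<sigma>, where 'a='a] by simp
qed (rule g(2))

text \<open>A level below g(r) is exceeded on the whole punctured ball of radius r, whose volume is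
  strictly larger than that of the ball of radius \<sigma>.\<close>

lemma rearr_radial_ge:
  assumes "0 < \<sigma>" "\<sigma> < r" "r \<le> R"
  shows "ennreal (g r) \<le> rearr (ball 0 R) f (measure lebesgue (ball (0::'a) 1) * \<sigma> ^ DIM('a))"
  unfolding rearr_def
proof (rule INF_greatest, safe)
  fix \<tau> :: real
  assume \<tau>: "0 \<le> \<tau>"
    and le: "distr_fun (ball 0 R) f \<tau> \<le> ennreal (measure lebesgue (ball (0::'a) 1) * \<sigma> ^ DIM('a))"
  have "g r \<le> \<tau>"
  proof (rule ccontr)
    assume "\<not> g r \<le> \<tau>"
    \<comment> \<open>Monotonicity holds on positive radii only and \<open>g 0 = 0\<close>, so the
      origin has to be removed.\<close>
    then have "g (norm x) > \<tau>" if "x \<in> ball 0 r - {0}" for x :: 'a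
      using that monotone_onD[OF g(1), of "norm x" r] assms by auto
    then have "emeasure lebesgue (ball (0::'a) r - {0}) \<le> distr_fun (ball 0 R) f \<tau>"
      unfolding distr_fun_radial using assms(3)
      by (intro emeasure_mono radial_superlevel_set_measurable) auto
    moreover have "emeasure lebesgue (ball (0::'a) r - {0}) = emeasure lebesgue (ball (0::'a) r)"
      by (rule emeasure_Diff_null_set) auto
    ultimately have "ennreal (measure lebesgue (ball (0::'a) 1) * r ^ DIM('a))
        \<le> ennreal (measure lebesgue (ball (0::'a) 1) * \<sigma> ^ DIM('a))"
      using le emeasure_ball_0[of r, where 'a='a] assms by (simp add: order_trans)
    moreover have "measure lebesgue (ball (0::'a) 1) > 0"
      by (simp add: content_ball)
    ultimately have "r ^ DIM('a) \<le> \<sigma> ^ DIM('a)"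
      using assms by (simp add: ennreal_le_iff)
    then show False
      using assms power_strict_mono[of \<sigma> r "DIM('a)"] by simp
  qed
  then show "ennreal (g r) \<le> ennreal \<tau>"
    by (rule ennreal_leI)
qed

text \<open>The lower bound is available for radii r > \<sigma> only. Letting r decrease to \<sigma>
  closes the gap at points of continuity of g.\<close>

lemma rearr_radial:
  assumes "0 < \<sigma>" "\<sigma> < R" "isCont g \<sigma>"
  shows "rearr (ball 0 R) f (measure lebesgue (ball (0::'a) 1) * \<sigma> ^ DIM('a)) = ennreal (g \<sigma>)"
proof (rule antisym[OF rearr_radial_le[OF assms(1)]])
  have "((\<lambda>r. ennreal (g r)) \<longlongrightarrow> ennreal (g \<sigma>)) (at_right \<sigma>)"
    using assms(3) by (intro tendsto_ennrealI) (auto simp: isCont_def filterlim_at_split)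
  moreover have "\<forall>\<^sub>F r in at_right \<sigma>. ennreal (g r)
      \<le> rearr (ball 0 R) f (measure lebesgue (ball (0::'a) 1) * \<sigma> ^ DIM('a))"
    using assms(1,2) rearr_radial_ge
    by (auto simp: eventually_at_right_field intro!: exI[of _ R])
  ultimately show "ennreal (g \<sigma>)
      \<le> rearr (ball 0 R) f (measure lebesgue (ball (0::'a) 1) * \<sigma> ^ DIM('a))"
    by (rule tendsto_upperbound) simp
qed

text \<open>The volume variable is replaced by a relative radius, T s^N with T the volume of the
  ball of radius r. The Jacobian T N s^(N-1) supplies the weight and the factor N, and its T cancels
  the division in \<open>max_rearr\<close>.\<close>

lemma max_rearr_radial:
  assumes r: "0 < r" "r < R"
  shows "max_rearr (ball 0 R) f (measure lebesgue (ball (0::'a) 1) * r ^ DIM('a)) =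
    ennreal (DIM('a)) * (\<integral>\<^sup>+s\<in>{0..1}. ennreal (g (r * s) * s ^ (DIM('a) - 1)) \<partial>lborel)"
proof -
  define N V T where "N = DIM('a)" and "V = measure lebesgue (ball (0::'a) 1)" and "T = V * r ^ N"
  have N: "N > 0" and V: "V > 0"
    by (auto simp: N_def V_def content_ball)
  then have T: "T > 0"
    using r by (simp add: T_def)
  note [measurable] = borel_measurable_if_antimono_on_halfline[OF g(1,3)]
  define F where "F = (\<lambda>s. ennreal (g (root N (s / V))))"
  have F [measurable]: "F \<in> borel_measurable borel"
    unfolding F_def by measurable
  define D where "D = (\<lambda>\<sigma>. V * \<sigma> ^ N) ` {\<sigma>\<in>{0<..}. \<not> isCont g \<sigma>}"
  have "countable D"
    unfolding D_def by (intro countable_image countable_discontinuities_antimono_on[OF g(1)]) simp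
  \<comment> \<open>Off these countably many volumes, s is the volume of a ball whose positive
    radius is a point of continuity of g.\<close>
  then have "AE s in lborel. s \<notin> D \<union> {0}"
    by (intro AE_not_in countable_imp_null_set_lborel) simp
  then have "AE s in lborel. rearr (ball 0 R) f s * indicator {0..T} s = F s * indicator {0..T} s"
  proof eventually_elim
    case (elim s)
    show ?case
    proof (cases "s \<in> {0..T}")
      case True
      define \<sigma> where "\<sigma> = root N (s / V)"
      have s: "0 < s" "s \<le> T"
        using True elim by auto
      then have \<sigma>: "0 < \<sigma>" "V * \<sigma> ^ N = s"
        using N V by (auto simp: \<sigma>_def)
      have "\<sigma> ^ N \<le> r ^ N"
        using s(2) V unfolding T_def \<sigma>(2)[symmetric] by simp
      then have "\<sigma> < R"
        using r \<sigma>(1) N power_le_imp_le_base[of \<sigma> "N - 1" r] by simp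
      moreover have "isCont g \<sigma>"
        using elim \<sigma> by (auto simp: D_def)
      ultimately have "rearr (ball 0 R) f s = ennreal (g \<sigma>)"
        using rearr_radial[of \<sigma>] \<sigma> by (simp add: N_def V_def)
      then show ?thesis
        by (simp add: F_def \<sigma>_def)
    qed simp
  qed
  then have "(\<integral>\<^sup>+s\<in>{0..T}. rearr (ball 0 R) f s \<partial>lborel) = (\<integral>\<^sup>+s\<in>{0..T}. F s \<partial>lborel)"
    by (rule nn_integral_cong_AE)
  \<comment> \<open>The endpoints are written as values of the substitution at 0 and 1, the shape
    its rule expects.\<close>
  also have "\<dots> = (\<integral>\<^sup>+s. F s * indicator {T * 0 ^ N..T * 1 ^ N} s \<partial>lborel)"
    using N by (simp add: zero_power)
  also have "\<dots> = (\<integral>\<^sup>+s. F (T * s ^ N) * ennreal (T * (N * s ^ (N - 1))) * indicator {0..1} s \<partial>lborel)"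
    using T N by (intro nn_integral_substitution_aux)
      (auto intro!: derivative_eq_intros continuous_intros)
  also have "\<dots> = (\<integral>\<^sup>+s. ennreal T * (ennreal N *
      (ennreal (g (r * s) * s ^ (N - 1)) * indicator {0..1} s)) \<partial>lborel)"
  proof (intro nn_integral_cong)
    fix s :: real
    have "F (T * s ^ N) * ennreal (T * (N * s ^ (N - 1))) =
        ennreal T * (ennreal N * ennreal (g (r * s) * s ^ (N - 1)))" if "s \<in> {0..1}"
    proof -
      have "root N (T * s ^ N / V) = r * s"
        using that r N V by (simp add: T_def power_mult_distrib[symmetric] real_root_power_cancel)
      then show ?thesis
        using that T g(2) by (simp add: F_def ennreal_mult'[symmetric] ennreal_mult''[symmetric] ac_simps)
    qed
    then show "F (T * s ^ N) * ennreal (T * (N * s ^ (N - 1))) * indicator {0..1} s =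
        ennreal T * (ennreal N * (ennreal (g (r * s) * s ^ (N - 1)) * indicator {0..1} s))"
      by (auto simp: indicator_def)
  qed
  also have "\<dots> = ennreal T * (ennreal N *
      (\<integral>\<^sup>+s\<in>{0..1}. ennreal (g (r * s) * s ^ (N - 1)) \<partial>lborel))"
    by (simp add: nn_integral_cmult)
  finally have "(\<integral>\<^sup>+s\<in>{0..T}. rearr (ball 0 R) f s \<partial>lborel) =
      ennreal T * (ennreal N * (\<integral>\<^sup>+s\<in>{0..1}. ennreal (g (r * s) * s ^ (N - 1)) \<partial>lborel))" .
  moreover have "ennreal T * A / ennreal T = A" for A
    using T by (subst mult.commute) (simp add: ennreal_mult_divide_eq)
  ultimately have "max_rearr (ball 0 R) f T =
      ennreal N * (\<integral>\<^sup>+s\<in>{0..1}. ennreal (g (r * s) * s ^ (N - 1)) \<partial>lborel)"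
    unfolding max_rearr_def by presburger
  then show ?thesis
    by (simp only: T_def V_def N_def)
qed

end

subsection \<open>The radial field with divergence \<open>f\<close>\<close>

lemma nn_integral_lborel_scaleR:
  fixes c :: real
  assumes [measurable]: "h \<in> borel_measurable (borel :: 'a::euclidean_space measure)" and "c > 0"
  shows "(\<integral>\<^sup>+x. h x \<partial>lborel) = ennreal (c ^ DIM('a)) * (\<integral>\<^sup>+x. h (c *\<^sub>R x) \<partial>lborel)"
  using assms(2) by (subst lborel_affine[of c 0])
    (simp_all add: nn_integral_density nn_integral_distr nn_integral_cmult)

lemma integral_lborel_scaleR:
  fixes c :: real and h :: "'a::euclidean_space \<Rightarrow> real"
  assumes [measurable]: "h \<in> borel_measurable borel" and "c > 0"
  shows "(\<integral>x. h x \<partial>lborel) = c ^ DIM('a) * (\<integral>x. h (c *\<^sub>R x) \<partial>lborel)"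
  using assms(2) by (subst lborel_affine[of c 0]) (simp_all add: integral_density integral_distr)

text \<open>The bridge between the completed measure on the ball, in which the weak equations are
  stated, and the Borel measure, for which Fubini and dilations are applied.\<close>

lemma integral_lebesgue_on_eq_lborel:
  fixes h :: "'a::euclidean_space \<Rightarrow> real"
  assumes "h \<in> borel_measurable borel" "S \<in> sets borel" "\<And>x. x \<notin> S \<Longrightarrow> h x = 0"
  shows "(\<integral>x. h x \<partial>lebesgue_on S) = (\<integral>x. h x \<partial>lborel)"
proof -
  have "(\<integral>x. h x \<partial>lebesgue_on S) = (\<integral>x. indicator S x *\<^sub>R h x \<partial>lebesgue)"
    using assms(2) by (subst integral_restrict_space) auto
  also have "(\<lambda>x. indicator S x *\<^sub>R h x) = h"
    using assms(3) by (auto simp: indicator_def fun_eq_iff)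
  finally show ?thesis
    using assms(1) by (simp add: integral_completion)
qed

text \<open>The integrand is the derivative in s of - \<phi>(y / s). The fundamental theorem leaves
  only the value at s = 1, because y / s leaves the ball as s decreases to 0.\<close>

lemma integral_radial_derivative_test_function:
  fixes y :: "'a::euclidean_space"
  assumes \<phi>: "\<phi> \<in> test_functions (ball 0 R)" and R: "R > 0" and y: "y \<noteq> 0"
  shows "(\<integral>s. indicator {0..1} s * (inverse (s\<^sup>2) * (y \<bullet> grad \<phi> (inverse s *\<^sub>R y))) \<partial>lborel) = - \<phi> y"
proof -
  \<comment> \<open>For s <= \<delta> the point y / s has norm at least R + |y|, hence lies outside
    the ball; this keeps the interval of integration away from the singularity at 0.\<close>
  define \<delta> where "\<delta> = norm y / (R + norm y)"
  have \<delta>: "0 < \<delta>" "\<delta> \<le> 1"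
    using R y by (auto simp: \<delta>_def field_simps add_pos_pos)
  have far: "norm (inverse s *\<^sub>R y) \<ge> R" if "0 < s" "s \<le> \<delta>" for s
  proof -
    have "s * (R + norm y) \<le> norm y"
      using that R by (simp add: \<delta>_def pos_le_divide_eq add_pos_nonneg)
    then have "R + norm y \<le> norm y / s"
      using that by (simp add: pos_le_divide_eq mult.commute)
    then have "R \<le> norm y / s"
      using norm_ge_zero[of y] by linarith
    then show ?thesis
      using that by (simp add: divide_inverse mult.commute)
  qed
  let ?f = "\<lambda>s. inverse (s\<^sup>2) * (y \<bullet> grad \<phi> (inverse s *\<^sub>R y))"
  have deriv: "((\<lambda>s. - \<phi> (inverse s *\<^sub>R y)) has_real_derivative ?f s) (at s)" if s: "s > 0" for s
  proof -
    have "((\<lambda>s. inverse s *\<^sub>R y) has_derivative (\<lambda>h. (- (inverse s * h * inverse s)) *\<^sub>R y)) (at s)"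
      using s by (auto intro!: derivative_eq_intros)
    from has_derivative_compose[OF this test_function_has_derivative[OF \<phi>]]
    have "((\<lambda>s. - \<phi> (inverse s *\<^sub>R y)) has_derivative
        (\<lambda>h. - (grad \<phi> (inverse s *\<^sub>R y) \<bullet> ((- (inverse s * h * inverse s)) *\<^sub>R y)))) (at s)"
      by (rule has_derivative_minus)
    then show ?thesis
      unfolding has_field_derivative_def
      by (rule has_derivative_eq_rhs)
        (auto simp: fun_eq_iff power2_eq_square inner_commute algebra_simps)
  qed
  have cont: "isCont ?f s" if "s > 0" for s
  proof -
    have "isCont (grad \<phi>) z" for z
      using test_function_continuous_grad[OF \<phi>] by (simp add: continuous_on_eq_continuous_at)
    moreover have "isCont (\<lambda>s. inverse s *\<^sub>R y) s"
      using that by (intro continuous_intros) simp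
    ultimately have "isCont (\<lambda>s. grad \<phi> (inverse s *\<^sub>R y)) s"
      by (rule isCont_o2[rotated])
    moreover have "isCont (\<lambda>s. inverse (s\<^sup>2)) s"
      using that by (intro continuous_intros) simp
    ultimately show ?thesis
      by (intro continuous_mult continuous_inner continuous_const)
  qed
  have "(\<integral>s. ?f s * indicator {\<delta>..1} s \<partial>lborel) = - \<phi> (inverse 1 *\<^sub>R y) - - \<phi> (inverse \<delta> *\<^sub>R y)"
    using \<delta> by (intro integral_FTC_Icc_real deriv cont) auto
  moreover have "\<phi> (inverse \<delta> *\<^sub>R y) = 0"
    using far[of \<delta>] \<delta> by (intro test_function_eq_0[OF \<phi>]) auto
  \<comment> \<open>Between 0 and \<delta> the gradient vanishes, and at s = 0 the integrand is 0
    because \<open>inverse 0 = 0\<close>.\<close>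
  moreover have "?f s * indicator {\<delta>..1} s = indicator {0..1} s * ?f s" for s
  proof (cases "0 < s \<and> s < \<delta>")
    case True
    then have "grad \<phi> (inverse s *\<^sub>R y) = 0"
      using far[of s] by (intro test_function_eq_0[OF \<phi>]) auto
    then show ?thesis by simp
  qed (use \<delta> in \<open>auto simp: indicator_def\<close>)
  ultimately show ?thesis by simp
qed

text \<open>Fubini and the dilation \<open>y = s x\<close> turn the left-hand side into the integral of \<open>g \<bar>y\<bar>\<close> times
  \<open>\<integral>\<^sub>0\<^sup>1 s\<^sup>-\<^sup>2 y \<bullet> \<nabla>\<phi> (y / s) ds\<close>, whose integrand is the derivative of \<open>- \<phi> (y / s)\<close> in \<open>s\<close>.\<close>

lemma integral_radial_mean_grad:
  fixes \<phi> :: "'a::euclidean_space \<Rightarrow> real" and g :: "real \<Rightarrow> real"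
  defines "A \<equiv> \<lambda>r. \<integral>\<^sup>+s\<in>{0..1}. ennreal (g (r * s) * s ^ (DIM('a) - 1)) \<partial>lborel"
  assumes \<phi>: "\<phi> \<in> test_functions (ball 0 R)" and R: "R > 0"
    and g [measurable]: "g \<in> borel_measurable borel" and g_nonneg: "\<And>t. 0 \<le> g t"
    and bound: "\<And>r. 0 < r \<Longrightarrow> r < R \<Longrightarrow> ennreal r * A r \<le> ennreal C"
  shows "(\<integral>x. enn2real (A (norm x)) * (x \<bullet> grad \<phi> x) \<partial>lborel) = - (\<integral>x. g (norm x) * \<phi> x \<partial>lborel)"
proof -
  define N where "N = DIM('a)"
  have N: "N > 0"
    by (simp add: N_def)
  have [measurable]: "grad \<phi> \<in> borel_measurable borel"
    by (rule borel_measurable_continuous_onI[OF test_function_continuous_grad[OF \<phi>]])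
  obtain B where B: "B \<ge> 0" "\<And>x. norm (grad \<phi> x) \<le> B"
    using test_function_bounded[OF \<phi>] by metis
  define k where "k = (\<lambda>(x::'a) s. indicator {0..1} s * (g (norm x * s) * s ^ (N - 1)) * (x \<bullet> grad \<phi> x))"
  define k' where "k' = (\<lambda>s (y::'a). g (norm y) *
      (indicator {0..1} s * (inverse (s\<^sup>2) * (y \<bullet> grad \<phi> (inverse s *\<^sub>R y)))))"
  have k [measurable]: "case_prod k \<in> borel_measurable (lborel \<Otimes>\<^sub>M lborel)"
    unfolding k_def by measurable
  have k' [measurable]: "case_prod k' \<in> borel_measurable (lborel \<Otimes>\<^sub>M lborel)"
    unfolding k'_def by measurable
  \<comment> \<open>The Jacobian s^N of y = s x meets s^(-2) and the factor s from the inner product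
    with s x, leaving s^(N-1).\<close>
  have scale: "s ^ N * k' s (s *\<^sub>R x) = k x s" if "s > 0" for s x
  proof -
    have "s ^ N = s * s ^ (N - 1)"
      using N by (simp add: power_eq_if)
    then show ?thesis
      using that by (simp add: k_def k'_def power2_eq_square mult.commute[of s "norm x"])
  qed
  have AE_ne: "AE s in lborel. s \<noteq> (0::real)"
    by (rule AE_lborel_singleton)
  have k_nonpos: "k x s = 0" "k' s x = 0" if "s < 0" for x s
    using that by (auto simp: k_def k'_def)

  have inner_A: "(\<integral>\<^sup>+s. ennreal \<bar>k x s\<bar> \<partial>lborel) = ennreal \<bar>x \<bullet> grad \<phi> x\<bar> * A (norm x)" for x
  proof -
    have "(\<integral>\<^sup>+s. ennreal \<bar>k x s\<bar> \<partial>lborel) = (\<integral>\<^sup>+s. ennreal \<bar>x \<bullet> grad \<phi> x\<bar> *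
        (ennreal (g (norm x * s) * s ^ (N - 1)) * indicator {0..1} s) \<partial>lborel)"
      using g_nonneg by (intro nn_integral_cong)
        (auto simp: k_def abs_mult indicator_def ennreal_mult' mult.commute)
    then show ?thesis
      by (simp add: nn_integral_cmult A_def N_def)
  qed
  \<comment> \<open>The factor x in the inner product with the gradient absorbs the possible blow-up
    of \<open>A\<close> at the origin: |x| A(|x|) is bounded by hypothesis.\<close>
  have "integrable (lborel \<Otimes>\<^sub>M lborel) (case_prod k)"
  proof (rule integrableI_bounded[OF k])
    have "(\<integral>\<^sup>+p. ennreal (norm (case_prod k p)) \<partial>(lborel \<Otimes>\<^sub>M lborel)) =
        (\<integral>\<^sup>+x. \<integral>\<^sup>+s. ennreal \<bar>k x s\<bar> \<partial>lborel \<partial>lborel)"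
      by (subst lborel.nn_integral_fst[symmetric]) simp_all
    also have "\<dots> \<le> (\<integral>\<^sup>+x. ennreal (B * C) * indicator (ball 0 R) (x::'a) \<partial>lborel)"
      unfolding inner_A
    proof (intro nn_integral_mono)
      fix x :: 'a
      show "ennreal \<bar>x \<bullet> grad \<phi> x\<bar> * A (norm x) \<le> ennreal (B * C) * indicator (ball 0 R) x"
      proof (cases "x = 0 \<or> norm x \<ge> R")
        case True
        then have "x \<bullet> grad \<phi> x = 0"
          using test_function_eq_0[OF \<phi>, of x] by auto
        then show ?thesis by simp
      next
        case False
        have "\<bar>x \<bullet> grad \<phi> x\<bar> \<le> B * norm x"
          using Cauchy_Schwarz_ineq2[of x "grad \<phi> x"] mult_left_mono[OF B(2)[of x] norm_ge_zero[of x]]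
          by (simp add: mult.commute)
        then have "ennreal \<bar>x \<bullet> grad \<phi> x\<bar> * A (norm x) \<le> ennreal (B * norm x) * A (norm x)"
          by (intro mult_right_mono ennreal_leI) auto
        also have "\<dots> = ennreal B * (ennreal (norm x) * A (norm x))"
          using B(1) by (simp add: ennreal_mult mult.assoc)
        also have "\<dots> \<le> ennreal B * ennreal C"
          using False by (intro mult_left_mono bound) auto
        finally show ?thesis
          using False B(1) by (simp add: ennreal_mult')
      qed
    qed
    also have "\<dots> < \<infinity>"
      using emeasure_bounded_finite[OF bounded_ball, of "0::'a" R]
      by (simp add: nn_integral_cmult_indicator ennreal_mult_less_top)
    finally show "(\<integral>\<^sup>+p. ennreal (norm (case_prod k p)) \<partial>(lborel \<Otimes>\<^sub>M lborel)) < \<infinity>" .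
  qed
  note int_k = this
  \<comment> \<open>Applied to absolute values, the same dilation carries the integrability over
    from \<open>k\<close>.\<close>
  have int_k': "integrable (lborel \<Otimes>\<^sub>M lborel) (case_prod k')"
  proof (rule integrableI_bounded[OF k'])
    have "(\<integral>\<^sup>+p. ennreal (norm (case_prod k' p)) \<partial>(lborel \<Otimes>\<^sub>M lborel)) =
        (\<integral>\<^sup>+s. \<integral>\<^sup>+y. ennreal \<bar>k' s y\<bar> \<partial>lborel \<partial>lborel)"
      by (subst lborel.nn_integral_fst[symmetric]) simp_all
    also have "\<dots> = (\<integral>\<^sup>+s. \<integral>\<^sup>+x. ennreal \<bar>k x s\<bar> \<partial>lborel \<partial>lborel)"
    proof (rule nn_integral_cong_AE, use AE_ne in eventually_elim)
      case (elim s)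
      show ?case
      proof (cases "s > 0")
        case True
        have "(\<integral>\<^sup>+y. ennreal \<bar>k' s y\<bar> \<partial>lborel) =
            ennreal (s ^ N) * (\<integral>\<^sup>+x. ennreal \<bar>k' s (s *\<^sub>R x)\<bar> \<partial>lborel)"
          unfolding N_def using True by (intro nn_integral_lborel_scaleR) measurable
        also have "\<dots> = (\<integral>\<^sup>+x. ennreal (s ^ N) * ennreal \<bar>k' s (s *\<^sub>R x)\<bar> \<partial>lborel)"
          by (rule nn_integral_cmult[symmetric]) measurable
        also have "\<dots> = (\<integral>\<^sup>+x. ennreal \<bar>k x s\<bar> \<partial>lborel)"
          using True by (simp add: scale[OF True, symmetric] ennreal_mult'[symmetric] abs_mult)
        finally show ?thesis .
      qed (use elim k_nonpos in simp)
    qed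
    also have "\<dots> = (\<integral>\<^sup>+p. ennreal (norm (case_prod k p)) \<partial>(lborel \<Otimes>\<^sub>M lborel))"
      by (subst lborel_pair.nn_integral_snd[symmetric]) simp_all
    also have "\<dots> < \<infinity>"
      using int_k by (simp add: integrable_iff_bounded)
    finally show "(\<integral>\<^sup>+p. ennreal (norm (case_prod k' p)) \<partial>(lborel \<Otimes>\<^sub>M lborel)) < \<infinity>" .
  qed
  have "(\<integral>x. enn2real (A (norm x)) * (x \<bullet> grad \<phi> x) \<partial>lborel) = (\<integral>x. \<integral>s. k x s \<partial>lborel \<partial>lborel)"
  proof (intro Bochner_Integration.integral_cong refl)
    fix x :: 'a
    have "(\<integral>s. indicator {0..1} s * (g (norm x * s) * s ^ (N - 1)) \<partial>lborel) = enn2real (A (norm x))"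
      using g_nonneg unfolding A_def N_def
      by (subst integral_eq_nn_integral)
        (auto simp: indicator_def intro!: arg_cong[where f=enn2real] nn_integral_cong)
    then show "enn2real (A (norm x)) * (x \<bullet> grad \<phi> x) = (\<integral>s. k x s \<partial>lborel)"
      unfolding k_def by (subst Bochner_Integration.integral_mult_left_zero) simp
  qed
  also have "\<dots> = (\<integral>s. \<integral>x. k x s \<partial>lborel \<partial>lborel)"
    by (rule lborel_pair.Fubini_integral[OF int_k, symmetric])
  also have "\<dots> = (\<integral>s. \<integral>y. k' s y \<partial>lborel \<partial>lborel)"
  proof (rule integral_cong_AE)
    show "AE s in lborel. (\<integral>x. k x s \<partial>lborel) = (\<integral>y. k' s y \<partial>lborel)"
      using AE_ne
    proof eventually_elim
      case (elim s)
      show ?case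
      proof (cases "s > 0")
        case True
        have "(\<integral>y. k' s y \<partial>lborel) = s ^ N * (\<integral>x. k' s (s *\<^sub>R x) \<partial>lborel)"
          unfolding N_def using True by (intro integral_lborel_scaleR) measurable
        then show ?thesis
          by (simp add: scale[OF True, symmetric])
      qed (use elim k_nonpos in simp)
    qed
  qed measurable
  also have "\<dots> = (\<integral>y. \<integral>s. k' s y \<partial>lborel \<partial>lborel)"
    by (rule lborel_pair.Fubini_integral[OF int_k', symmetric])
  also have "\<dots> = (\<integral>y. - (g (norm y) * \<phi> y) \<partial>lborel)"
  proof (rule integral_cong_AE)
    have "AE y in lborel. y \<noteq> (0::'a)"
      by (rule AE_lborel_singleton)
    then show "AE y in lborel. (\<integral>s. k' s y \<partial>lborel) = - (g (norm y) * \<phi> y)"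
    proof eventually_elim
      case (elim y)
      show ?case
        unfolding k'_def using integral_radial_derivative_test_function[OF \<phi> R elim] by simp
    qed
    have [measurable]: "\<phi> \<in> borel_measurable borel"
      by (rule borel_measurable_continuous_onI[OF test_function_continuous[OF \<phi>]])
    show "(\<lambda>y. - (g (norm y) * \<phi> y)) \<in> borel_measurable lborel"
      by measurable
  qed measurable
  finally show ?thesis by simp
qed

subsection \<open>Testing with the solution and with radial fields\<close>

text \<open>Young's inequality without sharp constants: according to whether t <= \<epsilon> m or
  not, one of the two terms alone dominates. The free parameter lets it replace Hoelder's inequality
  in the limit below.\<close>

lemma powr_mult_le_weighted_sum:
  fixes m t \<epsilon> p :: real
  assumes "p > 1" "m \<ge> 0" "t \<ge> 0" "\<epsilon> > 0"
  shows "m powr (p - 1) * t \<le> \<epsilon> * m powr p + \<epsilon> powr (1 - p) * t powr p"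
proof -
  have split: "s powr (p - 1) * s = s powr p" if "s \<ge> 0" for s :: real
    using powr_mult_base[OF that, of "p - 1"] by (simp add: mult.commute)
  show ?thesis
  proof (cases "t \<le> \<epsilon> * m")
    case True
    then have "m powr (p - 1) * t \<le> m powr (p - 1) * (\<epsilon> * m)"
      by (intro mult_left_mono) auto
    also have "\<dots> = \<epsilon> * m powr p"
      using split[OF assms(2)] by (simp add: mult.left_commute)
    finally show ?thesis
      using assms by (simp add: add_increasing2)
  next
    case False
    then have "m powr (p - 1) \<le> (t / \<epsilon>) powr (p - 1)"
      using assms by (intro powr_mono2) (auto simp: field_simps)
    also have "\<dots> = \<epsilon> powr (1 - p) * t powr (p - 1)"
      using assms powr_minus[of \<epsilon> "p - 1"] by (subst powr_divide) (auto simp: divide_inverse)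
    finally have "m powr (p - 1) * t \<le> \<epsilon> powr (1 - p) * t powr (p - 1) * t"
      using assms by (intro mult_right_mono) auto
    then show ?thesis
      using assms split[OF assms(3)] by (simp add: mult.assoc add_increasing)
  qed
qed

text \<open>The bound by m^(p-1) with m in L^p says that F lies in the dual of L^p. The term with
  \<epsilon> is made small first, uniformly in n, and the other one tends to 0 for this fixed
  \<epsilon>.\<close>

lemma integral_inner_tendsto_0:
  fixes F :: "'a \<Rightarrow> 'b::euclidean_space" and d :: "nat \<Rightarrow> 'a \<Rightarrow> 'b"
  assumes p: "p > 1" and [measurable]: "F \<in> borel_measurable M" "\<And>n. d n \<in> borel_measurable M"
    and m: "\<And>x. 0 \<le> m x" "integrable M (\<lambda>x. m x powr p)"
    and F: "\<And>x. x \<in> space M \<Longrightarrow> norm (F x) \<le> c * m x powr (p - 1)" and c: "c \<ge> 0"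
    and d: "\<And>n. integrable M (\<lambda>x. norm (d n x) powr p)"
    and lim: "(\<lambda>n. \<integral>x. norm (d n x) powr p \<partial>M) \<longlonglongrightarrow> 0"
  shows "integrable M (\<lambda>x. F x \<bullet> d n x)"
    and "(\<lambda>n. \<integral>x. F x \<bullet> d n x \<partial>M) \<longlonglongrightarrow> 0"
proof -
  define J where "J = (\<integral>x. m x powr p \<partial>M)"
  have J: "J \<ge> 0"
    by (simp add: J_def)
  have le: "\<bar>F x \<bullet> d n x\<bar> \<le> c * (\<epsilon> * m x powr p + \<epsilon> powr (1 - p) * norm (d n x) powr p)"
    if "\<epsilon> > 0" "x \<in> space M" for \<epsilon> n x
  proof -
    have "\<bar>F x \<bullet> d n x\<bar> \<le> norm (F x) * norm (d n x)"
      by (rule Cauchy_Schwarz_ineq2)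
    also have "\<dots> \<le> c * m x powr (p - 1) * norm (d n x)"
      using F that by (intro mult_right_mono) auto
    also have "\<dots> \<le> c * (\<epsilon> * m x powr p + \<epsilon> powr (1 - p) * norm (d n x) powr p)"
      unfolding mult.assoc
      by (intro mult_left_mono powr_mult_le_weighted_sum p m(1) norm_ge_zero that(1) c)
    finally show ?thesis .
  qed
  show int: "integrable M (\<lambda>x. F x \<bullet> d n x)" for n
  proof (rule Bochner_Integration.integrable_bound)
    show "integrable M (\<lambda>x. c * (1 * m x powr p + 1 powr (1 - p) * norm (d n x) powr p))"
      using m(2) d by simp
    show "AE x in M. norm (F x \<bullet> d n x) \<le>
        norm (c * (1 * m x powr p + 1 powr (1 - p) * norm (d n x) powr p))"
      using le[of 1] by (intro AE_I2) (fastforce intro: order_trans[OF _ abs_ge_self])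
  qed measurable
  have bound: "\<bar>\<integral>x. F x \<bullet> d n x \<partial>M\<bar> \<le>
      c * (\<epsilon> * J + \<epsilon> powr (1 - p) * (\<integral>x. norm (d n x) powr p \<partial>M))" if "\<epsilon> > 0" for \<epsilon> n
  proof -
    have "\<bar>\<integral>x. F x \<bullet> d n x \<partial>M\<bar> \<le>
        (\<integral>x. c * (\<epsilon> * m x powr p + \<epsilon> powr (1 - p) * norm (d n x) powr p) \<partial>M)"
      using int m(2) d le[OF that]
      by (intro order_trans[OF integral_abs_bound integral_mono]) auto
    also have "\<dots> = c * (\<epsilon> * J + \<epsilon> powr (1 - p) * (\<integral>x. norm (d n x) powr p \<partial>M))"
      using m(2) d by (simp add: J_def)
    finally show ?thesis .
  qed
  show "(\<lambda>n. \<integral>x. F x \<bullet> d n x \<partial>M) \<longlonglongrightarrow> 0"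
  proof (rule tendstoI)
    fix \<eta> :: real assume \<eta>: "\<eta> > 0"
    \<comment> \<open>Chosen so that the first term stays below half of \<eta>; the added 1 keeps
      the denominator positive when \<open>c * J = 0\<close>.\<close>
    define \<epsilon> where "\<epsilon> = \<eta> / (2 * (c * J + 1))"
    have cJ: "c * J \<ge> 0"
      using c J by simp
    then have \<epsilon>: "\<epsilon> > 0"
      using \<eta> by (simp add: \<epsilon>_def)
    have "c * (\<epsilon> * J) = \<eta> / 2 * (c * J / (c * J + 1))"
      by (simp add: \<epsilon>_def)
    also have "\<dots> < \<eta> / 2 * 1"
      using cJ \<eta> by (intro mult_strict_left_mono) auto
    finally have small: "c * (\<epsilon> * J) < \<eta> / 2" by simp
    have "(\<lambda>n. c * (\<epsilon> * J + \<epsilon> powr (1 - p) * (\<integral>x. norm (d n x) powr p \<partial>M)))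
        \<longlonglongrightarrow> c * (\<epsilon> * J + \<epsilon> powr (1 - p) * 0)"
      by (intro tendsto_intros lim)
    then have "\<forall>\<^sub>F n in sequentially.
        c * (\<epsilon> * J + \<epsilon> powr (1 - p) * (\<integral>x. norm (d n x) powr p \<partial>M)) < \<eta>"
      by (rule order_tendstoD) (use small \<eta> in simp)
    then show "\<forall>\<^sub>F n in sequentially. dist (\<integral>x. F x \<bullet> d n x \<partial>M) 0 < \<eta>"
      by eventually_elim (use bound[OF \<epsilon>] in \<open>auto simp: dist_real_def intro: le_less_trans\<close>)
  qed
qed

section \<open>Orthogonality to radial fields\<close>

lemma smooth_step_shifted_tendsto:
  assumes "t > 0"
  shows "(\<lambda>n. smooth_step n (t - 1 / (real n + 1))) \<longlonglongrightarrow> 1"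
proof -
  have "(\<lambda>n. 1 / (real n + 1)) \<longlonglongrightarrow> 0"
    using LIMSEQ_inverse_real_of_nat by (simp add: inverse_eq_divide add.commute)
  then have "(\<lambda>n. t - 1 / (real n + 1)) \<longlonglongrightarrow> t - 0"
    by (intro tendsto_intros)
  moreover have "isCont (flat_exp 1) t"
    using flat_exp_derivative DERIV_isCont by blast
  ultimately have "(\<lambda>n. flat_exp 1 (t - 1 / (real n + 1))) \<longlonglongrightarrow> flat_exp 1 t"
    by (intro isCont_tendsto_compose[where g="flat_exp 1"]) simp_all
  moreover have "flat_exp 1 t > 0"
    using assms by (simp add: flat_exp_def)
  \<comment> \<open>The flat function at the shifted argument tends to a positive limit, so the
    exponent still grows linearly in n.\<close>
  ultimately have "filterlim (\<lambda>n. flat_exp 1 (t - 1 / (real n + 1)) * real n) at_top sequentially"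
    by (rule filterlim_tendsto_pos_mult_at_top) (rule filterlim_real_sequentially)
  then have "(\<lambda>n. exp (- (flat_exp 1 (t - 1 / (real n + 1)) * real n))) \<longlonglongrightarrow> 0"
    by (intro filterlim_compose[OF exp_at_bot] filterlim_compose[OF filterlim_uminus_at_bot_at_top])
  then have "(\<lambda>n. 1 - exp (- (flat_exp 1 (t - 1 / (real n + 1)) * real n))) \<longlonglongrightarrow> 1 - 0"
    by (intro tendsto_intros)
  then show ?thesis
    by (simp add: smooth_step_def mult.commute)
qed

text \<open>The function is G(|x|^2) with G' = k. Working with the squared norm avoids the
  singularity of |x| at the origin and turns every smooth k that vanishes early enough into a radial
  gradient.\<close>

lemma radial_test_function:
  fixes k :: "real \<Rightarrow> real"
  assumes k: "smooth_real k" "\<And>t. t \<ge> b \<Longrightarrow> k t = 0" and b: "0 \<le> b" "b < R\<^sup>2" and R: "R > 0"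
  obtains \<phi> where "\<phi> \<in> test_functions (ball (0::'a::euclidean_space) R)"
    "\<And>x. grad \<phi> x = (2 * k ((norm x)\<^sup>2)) *\<^sub>R x"
proof -
  have cont: "isCont k t" for t
    using smooth_realE[OF k(1)] DERIV_isCont by metis
  obtain G0 where G0: "\<And>t. (G0 has_real_derivative k t) (at t)"
    using einterval_antiderivative[of "-\<infinity>" \<infinity> k] cont
    by (auto simp: has_real_derivative_iff_has_vector_derivative)
  \<comment> \<open>Since k vanishes beyond b, normalising the antiderivative at b makes G vanish
    there too, so the support lies in the ball of radius sqrt b < R.\<close>
  define G where "G = (\<lambda>t. G0 t - G0 b)"
  have G: "(G has_real_derivative k t) (at t)" for t
    unfolding G_def by (auto intro!: derivative_eq_intros G0)
  have G_0: "G t = 0" if "t \<ge> b" for t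
  proof (cases "t = b")
    case False
    have "G t = G b"
    proof (rule DERIV_isconst2[of b t])
      show "continuous_on {b..t} G"
        using G by (intro continuous_at_imp_continuous_on ballI) (rule DERIV_isCont)
      show "DERIV G s :> 0" if "b < s" for s
        using G[of s] k(2)[of s] that by simp
    qed (use that False in auto)
    then show ?thesis by (simp add: G_def)
  qed (simp add: G_def)
  show ?thesis
  proof
    show "(\<lambda>x. G ((norm x)\<^sup>2)) \<in> test_functions (ball (0::'a) R)"
    proof (rule test_functionsI)
      show "smooth_expr (\<lambda>x::'a. G ((norm x)\<^sup>2))"
        by (rule smooth_expr.comp[OF smooth_real_antiderivative[OF k(1) G] smooth_expr_norm_square])
      show "compact (cball (0::'a) (sqrt b))"
        by simp
      show "cball (0::'a) (sqrt b) \<subseteq> ball 0 R"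
        using b R real_sqrt_less_mono[OF b(2)] by auto
      show "x \<in> cball 0 (sqrt b)" if "G ((norm x)\<^sup>2) \<noteq> 0" for x :: 'a
      proof -
        have "(norm x)\<^sup>2 < b"
          using that G_0 by (meson not_le_imp_less)
        then show ?thesis
          by (simp add: real_le_rsqrt)
      qed
    qed
    show "grad (\<lambda>x. G ((norm x)\<^sup>2)) x = (2 * k ((norm x)\<^sup>2)) *\<^sub>R x" for x :: 'a
    proof (rule grad_eqI)
      have "((\<lambda>x::'a. (norm x)\<^sup>2) has_derivative (\<lambda>v. 2 * (x \<bullet> v))) (at x)"
        unfolding power2_norm_eq_inner
        by (auto intro!: derivative_eq_intros simp: inner_commute)
      from DERIV_compose_FDERIV[OF G this]
      show "((\<lambda>x. G ((norm x)\<^sup>2)) has_derivative (\<lambda>v. (2 * k ((norm x)\<^sup>2)) *\<^sub>R x \<bullet> v)) (at x)"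
        by (simp add: mult_ac)
    qed
  qed
qed

lemma AE_lebesgue_on_neq:
  fixes c :: "'a::euclidean_space"
  assumes "S \<in> sets lebesgue"
  shows "AE x in lebesgue_on S. x \<noteq> c"
  using AE_completion[OF AE_lborel_singleton[of c]] assms
  by (subst AE_restrict_space_iff) auto

text \<open>Orthogonality passes from smooth profiles vanishing near the boundary to polynomials in
  |x|^2, then to continuous functions of |x|^2, and finally by dominated convergence to w(|x|) /
  |x|. The pole at the origin is harmless because |F . x| <= |F| |x|.\<close>

lemma integral_radial_direction_eq_0:
  fixes F :: "'a::euclidean_space \<Rightarrow> 'a" and w :: "real \<Rightarrow> real"
  assumes R: "R > 0" and F: "integrable (lebesgue_on (ball 0 R)) F"
    and orth: "\<And>\<phi>. \<phi> \<in> test_functions (ball 0 R) \<Longrightarrow> (\<integral>x. F x \<bullet> grad \<phi> x \<partial>lebesgue_on (ball 0 R)) = 0"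
    and w: "continuous_on {0<..<R} w" "\<And>r. 0 < r \<Longrightarrow> r < R \<Longrightarrow> \<bar>w r\<bar> \<le> B"
  shows "(\<integral>x. w (norm x) / norm x * (F x \<bullet> x) \<partial>lebesgue_on (ball 0 R)) = 0"
    and "integrable (lebesgue_on (ball 0 R)) (\<lambda>x. w (norm x) / norm x * (F x \<bullet> x))"
proof -
  define M where "M = lebesgue_on (ball (0::'a) R)"
  have M: "space M = ball 0 R"
    by (simp add: M_def)
  note [measurable] = borel_measurable_integrable[OF F, folded M_def]
  have id [measurable]: "(\<lambda>x. x) \<in> borel_measurable M"
    unfolding M_def by (intro measurable_restrict_space1 measurable_completion) simp
  have norm_less: "norm x < R" if "x \<in> space M" for x
    using that by (simp add: M)
  have B: "B \<ge> 0"
    using w(2)[of "R / 2"] R by (simp add: order_trans[OF abs_ge_zero])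
  define \<psi> where "\<psi> = (\<lambda>x. F x \<bullet> x)"
  have \<psi>_le: "\<bar>\<psi> x\<bar> \<le> norm (F x) * norm x" for x
    unfolding \<psi>_def by (rule Cauchy_Schwarz_ineq2)
  have \<psi>: "integrable M \<psi>"
  proof (rule Bochner_Integration.integrable_bound)
    show "integrable M (\<lambda>x. R * norm (F x))"
      using F by (simp add: M_def)
    show "AE x in M. norm (\<psi> x) \<le> norm (R * norm (F x))"
    proof (rule AE_I2)
      fix x assume "x \<in> space M"
      then have "norm (F x) * norm x \<le> norm (F x) * R"
        using norm_less by (intro mult_left_mono) (auto intro: less_imp_le)
      then show "norm (\<psi> x) \<le> norm (R * norm (F x))"
        using \<psi>_le[of x] R by (simp add: abs_mult mult.commute)
    qed
  qed (simp add: \<psi>_def)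
  note [measurable] = borel_measurable_integrable[OF this]
  have orth': "(\<integral>x. k ((norm x)\<^sup>2) * \<psi> x \<partial>M) = 0"
    if k: "smooth_real k" "\<And>t. t \<ge> b \<Longrightarrow> k t = 0" "0 \<le> b" "b < R\<^sup>2" for k b
  proof -
    obtain \<phi> where "\<phi> \<in> test_functions (ball (0::'a) R)" "\<And>x. grad \<phi> x = (2 * k ((norm x)\<^sup>2)) *\<^sub>R x"
      using radial_test_function[OF k R] by metis
    from orth[OF this(1)] this(2) have "(\<integral>x. 2 * (k ((norm x)\<^sup>2) * \<psi> x) \<partial>M) = 0"
      by (simp add: M_def \<psi>_def mult.assoc)
    then show ?thesis by simp
  qed
  have poly: "(\<integral>x. q ((norm x)\<^sup>2) * \<psi> x \<partial>M) = 0" if q: "real_polynomial_function q" for q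
  proof -
    have cq: "continuous_on UNIV q"
      using q by (simp add: continuous_on_polymonial_function real_polynomial_function_eq)
    have [measurable]: "q \<in> borel_measurable borel"
      by (rule borel_measurable_continuous_onI[OF cq])
    have "bounded (q ` {0..R\<^sup>2})"
      using cq by (intro compact_imp_bounded compact_continuous_image) (auto intro: continuous_on_subset)
    then obtain D where D: "\<And>t. t \<in> {0..R\<^sup>2} \<Longrightarrow> \<bar>q t\<bar> \<le> D"
      by (metis bounded_iff imageI real_norm_def)
    have D_nonneg: "D \<ge> 0"
      using D[of 0] R by (simp add: order_trans[OF abs_ge_zero])
    \<comment> \<open>The shift by 1 / (n + 1) makes the profile vanish for t near R^2, so that the
      support is compact in the open ball.\<close>
    define k where "k = (\<lambda>n t. q t * smooth_step n (R\<^sup>2 - t - 1 / (real n + 1)))"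
    have smooth_k: "smooth_expr (k n)" for n
      unfolding k_def
      by (intro smooth_expr.mult smooth_expr_polynomial[OF q] smooth_expr_smooth_step smooth_expr_diff
          smooth_expr.const smooth_expr.linear bounded_linear_ident)
    have "(\<integral>x. k n ((norm x)\<^sup>2) * \<psi> x \<partial>M) = 0" for n
    proof (rule orth')
      show "smooth_real (k n)"
        by (rule smooth_real_if_smooth_expr[OF smooth_k])
      \<comment> \<open>The maximum covers the case R^2 < 1 / (n + 1), in which the cutoff vanishes
        for all t >= 0.\<close>
      show "0 \<le> max 0 (R\<^sup>2 - 1 / (real n + 1))" "max 0 (R\<^sup>2 - 1 / (real n + 1)) < R\<^sup>2"
        using R by auto
    qed (simp add: k_def)
    moreover have "(\<lambda>n. \<integral>x. k n ((norm x)\<^sup>2) * \<psi> x \<partial>M) \<longlonglongrightarrow> (\<integral>x. q ((norm x)\<^sup>2) * \<psi> x \<partial>M)"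
    proof (rule integral_dominated_convergence)
      show "integrable M (\<lambda>x. D * \<bar>\<psi> x\<bar>)"
        using \<psi> by simp
      have "k n \<in> borel_measurable borel" for n
        using smooth_expr_Ck[OF smooth_k, of 0] by (simp add: borel_measurable_continuous_onI)
      then show "(\<lambda>x. k n ((norm x)\<^sup>2) * \<psi> x) \<in> borel_measurable M" for n
        by measurable
      show "AE x in M. (\<lambda>n. k n ((norm x)\<^sup>2) * \<psi> x) \<longlonglongrightarrow> q ((norm x)\<^sup>2) * \<psi> x"
      proof (rule AE_I2)
        fix x assume "x \<in> space M"
        then have "R\<^sup>2 - (norm x)\<^sup>2 > 0"
          using norm_less[of x] by (simp add: power_strict_mono)
        then have "(\<lambda>n. k n ((norm x)\<^sup>2) * \<psi> x) \<longlonglongrightarrow> q ((norm x)\<^sup>2) * 1 * \<psi> x"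
          unfolding k_def by (intro tendsto_intros smooth_step_shifted_tendsto)
        then show "(\<lambda>n. k n ((norm x)\<^sup>2) * \<psi> x) \<longlonglongrightarrow> q ((norm x)\<^sup>2) * \<psi> x"
          by simp
      qed
      show "AE x in M. norm (k n ((norm x)\<^sup>2) * \<psi> x) \<le> D * \<bar>\<psi> x\<bar>" for n
      proof (rule AE_I2)
        fix x assume "x \<in> space M"
        then have "(norm x)\<^sup>2 \<in> {0..R\<^sup>2}"
          using norm_less[of x] by (simp add: power_mono)
        then have "\<bar>q ((norm x)\<^sup>2)\<bar> * \<bar>smooth_step n (R\<^sup>2 - (norm x)\<^sup>2 - 1 / (real n + 1))\<bar> \<le> D * 1"
          using D smooth_step_bounds[of n] D_nonneg by (intro mult_mono) auto
        then show "norm (k n ((norm x)\<^sup>2) * \<psi> x) \<le> D * \<bar>\<psi> x\<bar>"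
          by (simp add: k_def abs_mult mult_right_mono)
      qed
    qed measurable
    ultimately show ?thesis
      by (simp add: LIMSEQ_const_iff)
  qed
  have cont: "(\<integral>x. h ((norm x)\<^sup>2) * \<psi> x \<partial>M) = 0" if h: "continuous_on UNIV h" for h
  proof (rule integral_eq_0_if_orthogonal_to_polynomials[where T="\<lambda>x. (norm x)\<^sup>2" and S="{0..R\<^sup>2}"])
    have [measurable]: "h \<in> borel_measurable borel"
      by (rule borel_measurable_continuous_onI[OF h])
    show "(\<lambda>x. h ((norm x)\<^sup>2)) \<in> borel_measurable M" "(\<lambda>x. (norm x)\<^sup>2) \<in> borel_measurable M"
      by measurable
    show "continuous_on {0..R\<^sup>2} h"
      using h by (rule continuous_on_subset) simp
    show "(norm x)\<^sup>2 \<in> {0..R\<^sup>2}" if "x \<in> space M" for x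
      using norm_less[OF that] by (simp add: power_mono)
  qed (use \<psi> poly in auto)
  \<comment> \<open>At most R / 2, so clamping the radius to the interval from \<epsilon> n to R -
    \<epsilon> n is meaningful and stays where w is continuous. This yields a profile continuous on
    the whole line.\<close>
  define \<epsilon> where "\<epsilon> = (\<lambda>n. R / (real n + 2))"
  have \<epsilon>: "0 < \<epsilon> n" "\<epsilon> n < R" for n
    using R by (auto simp: \<epsilon>_def field_simps add_pos_nonneg)
  define cl where "cl = (\<lambda>n r. max (\<epsilon> n) (min r (R - \<epsilon> n)))"
  have cl: "cl n r \<in> {0<..<R}" for n r
    using \<epsilon>[of n] by (auto simp: cl_def)
  define h where "h = (\<lambda>n t. w (cl n (sqrt t)) / max (\<epsilon> n) (sqrt t))"
  have h_cont: "continuous_on UNIV (h n)" for n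
    unfolding h_def
  proof (intro continuous_on_divide)
    have "continuous_on UNIV (\<lambda>t. cl n (sqrt t))"
      unfolding cl_def by (intro continuous_intros)
    then show "continuous_on UNIV (\<lambda>t. w (cl n (sqrt t)))"
      using cl by (intro continuous_on_compose2[OF w(1)]) auto
    show "continuous_on UNIV (\<lambda>t. max (\<epsilon> n) (sqrt t))"
      by (intro continuous_intros)
    show "\<forall>t\<in>UNIV. max (\<epsilon> n) (sqrt t) \<noteq> 0"
      using \<epsilon>(1)[of n] by (auto simp: max_def)
  qed
  have meas_h: "(\<lambda>x. h n ((norm x)\<^sup>2) * \<psi> x) \<in> borel_measurable M" for n
  proof -
    have [measurable]: "h n \<in> borel_measurable borel"
      by (rule borel_measurable_continuous_onI[OF h_cont])
    show ?thesis by measurable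
  qed
  have AE_0: "AE x in M. x \<noteq> 0"
    unfolding M_def by (rule AE_lebesgue_on_neq) simp
  have lim: "AE x in M. (\<lambda>n. h n ((norm x)\<^sup>2) * \<psi> x) \<longlonglongrightarrow> w (norm x) / norm x * \<psi> x"
    using AE_0 AE_space
  proof eventually_elim
    case (elim x)
    then have r: "0 < norm x" "norm x < R"
      using norm_less by auto
    have "(\<lambda>n. inverse (real n + 2)) \<longlonglongrightarrow> 0"
      using LIMSEQ_ignore_initial_segment[OF LIMSEQ_inverse_real_of_nat, of 1]
      by (simp add: add.commute)
    then have "(\<lambda>n. R * inverse (real n + 2)) \<longlonglongrightarrow> R * 0"
      by (intro tendsto_intros)
    then have \<epsilon>_lim: "\<epsilon> \<longlonglongrightarrow> 0"
      by (simp add: \<epsilon>_def divide_inverse)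
    have "(\<lambda>n. cl n (norm x)) \<longlonglongrightarrow> max 0 (min (norm x) (R - 0))"
      unfolding cl_def by (intro tendsto_intros \<epsilon>_lim)
    then have "(\<lambda>n. cl n (norm x)) \<longlonglongrightarrow> norm x"
      using r by simp
    moreover have "isCont w (norm x)"
      using w(1) r by (simp add: continuous_on_eq_continuous_at)
    ultimately have 1: "(\<lambda>n. w (cl n (norm x))) \<longlonglongrightarrow> w (norm x)"
      by (rule isCont_tendsto_compose[rotated])
    have "(\<lambda>n. max (\<epsilon> n) (norm x)) \<longlonglongrightarrow> max 0 (norm x)"
      by (intro tendsto_intros \<epsilon>_lim)
    then have 2: "(\<lambda>n. max (\<epsilon> n) (norm x)) \<longlonglongrightarrow> norm x"
      by simp
    show ?case
      unfolding h_def using r by (auto intro!: tendsto_intros 1 2)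
  qed
  \<comment> \<open>The quotient of |x| by max(\<epsilon> n, |x|) is at most 1, which makes the
    bound independent of n although the weights grow like 1 / \<epsilon> n.\<close>
  have dom: "AE x in M. norm (h n ((norm x)\<^sup>2) * \<psi> x) \<le> B * norm (F x)" for n
  proof (rule AE_I2)
    fix x
    have "\<bar>h n ((norm x)\<^sup>2) * \<psi> x\<bar> \<le> \<bar>h n ((norm x)\<^sup>2)\<bar> * (norm (F x) * norm x)"
      unfolding abs_mult by (intro mult_left_mono \<psi>_le) simp
    also have "\<dots> = \<bar>w (cl n (norm x))\<bar> * (norm x / max (\<epsilon> n) (norm x)) * norm (F x)"
      using \<epsilon>(1)[of n] by (simp add: h_def)
    also have "\<dots> \<le> B * 1 * norm (F x)"
      using w(2) cl[of n] \<epsilon>(1)[of n] B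
      by (intro mult_right_mono mult_mono) (auto simp: divide_le_eq_1 max_def)
    finally show "norm (h n ((norm x)\<^sup>2) * \<psi> x) \<le> B * norm (F x)"
      by simp
  qed
  have meas_w: "(\<lambda>x. w (norm x) / norm x * \<psi> x) \<in> borel_measurable M"
  proof -
    \<comment> \<open>Extension by zero makes w Borel on the line. On the ball nothing changes: at
      the origin both quotients are 0 through the division by \<open>norm x\<close>.\<close>
    have "(\<lambda>r. indicator {0<..<R} r *\<^sub>R w r) \<in> borel_measurable borel"
      using w(1) by (intro borel_measurable_continuous_on_indicator) auto
    then have [measurable]: "(\<lambda>r. indicator {0<..<R} r * w r) \<in> borel_measurable borel"
      by simp
    have "(\<lambda>x. (\<lambda>r. indicator {0<..<R} r * w r) (norm x) / norm x * \<psi> x) \<in> borel_measurable M"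
      by measurable
    also have "?this \<longleftrightarrow> ?thesis"
      by (intro measurable_cong) (use norm_less in \<open>auto simp: indicator_def\<close>)
    finally show ?thesis .
  qed
  have int_F: "integrable M (\<lambda>x. B * norm (F x))"
    using F by (simp add: M_def)
  note dct = meas_w meas_h int_F lim dom
  have "(\<lambda>n. \<integral>x. h n ((norm x)\<^sup>2) * \<psi> x \<partial>M) \<longlonglongrightarrow> (\<integral>x. w (norm x) / norm x * \<psi> x \<partial>M)"
    by (rule integral_dominated_convergence[OF dct])
  then have "(\<integral>x. w (norm x) / norm x * \<psi> x \<partial>M) = 0"
    by (simp add: cont[OF h_cont] LIMSEQ_const_iff)
  then show "(\<integral>x. w (norm x) / norm x * (F x \<bullet> x) \<partial>lebesgue_on (ball 0 R)) = 0"
    by (simp add: M_def \<psi>_def)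
  show "integrable (lebesgue_on (ball 0 R)) (\<lambda>x. w (norm x) / norm x * (F x \<bullet> x))"
    using integrable_dominated_convergence[OF dct] by (simp add: M_def \<psi>_def)
qed

text \<open>Although g may jump, rescaling writes the mean as r^(-N) times an indefinite integral
  from 0 to r, which is continuous in its upper limit.\<close>

lemma continuous_on_radial_mean:
  fixes g :: "real \<Rightarrow> real" and N :: nat
  defines "A \<equiv> \<lambda>r. \<integral>\<^sup>+s\<in>{0..1}. ennreal (g (r * s) * s ^ (N - 1)) \<partial>lborel"
  assumes g [measurable]: "g \<in> borel_measurable borel" and g_nonneg: "\<And>t. 0 \<le> g t" and N: "N > 0"
    and fin: "\<And>r. 0 < r \<Longrightarrow> r < R \<Longrightarrow> A r < \<infinity>"
  shows "continuous_on {0<..<R} (\<lambda>r. enn2real (A r))"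
proof -
  let ?h = "\<lambda>t. g t * t ^ (N - 1)"
  have nn: "(\<integral>\<^sup>+t\<in>{0..r}. ennreal (?h t) \<partial>lborel) = ennreal (r ^ N) * A r" if r: "r > 0" for r
  proof -
    have "(\<integral>\<^sup>+t\<in>{0..r}. ennreal (?h t) \<partial>lborel) =
        ennreal r * (\<integral>\<^sup>+s. ennreal (?h (r * s)) * indicator {0..r} (r * s) \<partial>lborel)"
      using r nn_integral_real_affine[of "\<lambda>t. ennreal (?h t) * indicator {0..r} t" r 0] by simp
    also have "(\<integral>\<^sup>+s. ennreal (?h (r * s)) * indicator {0..r} (r * s) \<partial>lborel) =
        (\<integral>\<^sup>+s. ennreal (r ^ (N - 1)) * (ennreal (g (r * s) * s ^ (N - 1)) * indicator {0..1} s) \<partial>lborel)"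
    proof (intro nn_integral_cong)
      fix s
      have "indicator {0..r} (r * s) = (indicator {0..1} s :: ennreal)"
        using r by (auto simp: indicator_def zero_le_mult_iff)
      moreover have "?h (r * s) = r ^ (N - 1) * (g (r * s) * s ^ (N - 1))"
        by (simp add: power_mult_distrib)
      ultimately show "ennreal (?h (r * s)) * indicator {0..r} (r * s) =
          ennreal (r ^ (N - 1)) * (ennreal (g (r * s) * s ^ (N - 1)) * indicator {0..1} s)"
        using r by (simp only: ennreal_mult'[of "r ^ (N - 1)"] zero_le_power less_imp_le mult.assoc)
    qed
    also have "ennreal r * \<dots> = ennreal r * ennreal (r ^ (N - 1)) * A r"
      by (simp add: A_def nn_integral_cmult mult.assoc)
    also have "ennreal r * ennreal (r ^ (N - 1)) = ennreal (r ^ N)"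
      using r N by (simp add: ennreal_mult'[symmetric] power_eq_if)
    finally show ?thesis .
  qed
  have ind: "ennreal (indicator {0..r} t *\<^sub>R ?h t) = ennreal (?h t) * indicator {0..r} t" for r t
    by (simp add: indicator_def)
  have repr: "enn2real (A r) = integral {0..r} ?h / r ^ N" and int: "?h integrable_on {0..r}"
    if r: "0 < r" "r < R" for r
  proof -
    have "set_integrable lborel {0..r} ?h"
      unfolding set_integrable_def
    proof (rule integrableI_nonneg)
      have "(\<integral>\<^sup>+t. ennreal (indicator {0..r} t *\<^sub>R ?h t) \<partial>lborel) = ennreal (r ^ N) * A r"
        unfolding ind by (rule nn[OF r(1)])
      also have "\<dots> < \<infinity>"
        using fin[OF r] by (simp add: ennreal_mult_less_top)
      finally show "(\<integral>\<^sup>+t. ennreal (indicator {0..r} t *\<^sub>R ?h t) \<partial>lborel) < \<infinity>" .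
    qed (use g_nonneg in \<open>auto simp: indicator_def\<close>)
    note set_int = set_borel_integral_eq_integral[OF this]
    show "?h integrable_on {0..r}"
      by (rule set_int(1))
    have "integral {0..r} ?h = enn2real (\<integral>\<^sup>+t. ennreal (indicator {0..r} t *\<^sub>R ?h t) \<partial>lborel)"
      unfolding set_int(2)[symmetric] set_lebesgue_integral_def
      using g_nonneg by (intro integral_eq_nn_integral) (auto simp: indicator_def)
    also have "(\<integral>\<^sup>+t. ennreal (indicator {0..r} t *\<^sub>R ?h t) \<partial>lborel) = ennreal (r ^ N) * A r"
      unfolding ind by (rule nn[OF r(1)])
    finally show "enn2real (A r) = integral {0..r} ?h / r ^ N"
      using r by (simp add: enn2real_mult)
  qed
  have "isCont (\<lambda>r. enn2real (A r)) r" if r: "0 < r" "r < R" for r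
  proof -
    define c where "c = (r + R) / 2"
    have c: "r < c" "c < R"
      using r by (auto simp: c_def)
    have "continuous_on {0..c} (\<lambda>r. integral {0..r} ?h)"
      using int[of c] r c by (intro indefinite_integral_continuous_1) auto
    then have "continuous_on {0<..<c} (\<lambda>r. integral {0..r} ?h)"
      by (rule continuous_on_subset) auto
    then have "continuous_on {0<..<c} (\<lambda>r. integral {0..r} ?h / r ^ N)"
      by (intro continuous_on_divide continuous_on_power continuous_on_id) auto
    then have "continuous_on {0<..<c} (\<lambda>r. enn2real (A r))"
      by (rule continuous_on_eq) (use c repr in auto)
    then show ?thesis
      using r c by (simp add: continuous_on_eq_continuous_at)
  qed
  then show ?thesis
    by (intro continuous_at_imp_continuous_on) auto
qed

text \<open>Truncations to closed balls exhausting the open ball are measurable and are eventually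
  equal to \<open>E\<close> at each point.\<close>

lemma borel_measurable_if_locally_integrable_on_ball:
  fixes E :: "'a::euclidean_space \<Rightarrow> 'b::euclidean_space"
  assumes R: "R > 0" and E: "E locally_integrable_on ball 0 R"
  shows "E \<in> borel_measurable (lebesgue_on (ball 0 R))"
proof (rule borel_measurable_LIMSEQ_metric)
  fix n :: nat
  have "0 < R / (real n + 2)"
    using R by simp
  then have "cball 0 (R - R / (real n + 2)) \<subseteq> ball (0::'a) R"
    by auto
  then have "integrable lebesgue (\<lambda>x. indicator (cball 0 (R - R / (real n + 2))) x *\<^sub>R E x)"
    using E by (auto simp: locally_integrable_on_def set_integrable_def)
  then show "(\<lambda>x. indicator (cball 0 (R - R / (real n + 2))) x *\<^sub>R E x)
      \<in> borel_measurable (lebesgue_on (ball 0 R))"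
    by (intro measurable_restrict_space1 borel_measurable_integrable)
next
  fix x :: 'a assume "x \<in> space (lebesgue_on (ball 0 R))"
  then have x: "0 < R - norm x"
    by simp
  have "(\<lambda>n. inverse (real n + 2)) \<longlonglongrightarrow> 0"
    using LIMSEQ_ignore_initial_segment[OF LIMSEQ_inverse_real_of_nat, of 1]
    by (simp add: add.commute)
  then have "(\<lambda>n. R * inverse (real n + 2)) \<longlonglongrightarrow> R * 0"
    by (intro tendsto_intros)
  then have "\<forall>\<^sub>F n in sequentially. R * inverse (real n + 2) < R - norm x"
    by (rule order_tendstoD) (use x in simp)
  then have "\<forall>\<^sub>F n in sequentially. indicator (cball 0 (R - R / (real n + 2))) x *\<^sub>R E x = E x"
    by eventually_elim (auto simp: divide_inverse indicator_def)
  then show "(\<lambda>n. indicator (cball 0 (R - R / (real n + 2))) x *\<^sub>R E x) \<longlonglongrightarrow> E x"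
    by (rule tendsto_eventually)
qed

text \<open>Taking norms in the equation gives |\<xi>| - 1 = q, so the factor in front of \<xi> is q
  / (1 + q) and can be divided out.\<close>

lemma H_1_eq_imp:
  fixes \<xi> e :: "'a::euclidean_space"
  assumes "norm \<xi> > 1" "norm e = 1" "q \<ge> 0" "H 1 \<xi> = - (q *\<^sub>R e)"
  shows "\<xi> = - ((1 + q) *\<^sub>R e)"
proof -
  define c where "c = (norm \<xi> - 1) / norm \<xi>"
  have c: "c > 0" "c *\<^sub>R \<xi> = - (q *\<^sub>R e)"
    using assms less_trans[OF zero_less_one assms(1)] by (simp_all add: c_def H_eq)
  have "norm (c *\<^sub>R \<xi>) = norm (- (q *\<^sub>R e))"
    by (simp only: c)
  moreover have "norm (c *\<^sub>R \<xi>) = norm \<xi> - 1"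
    using assms(1) by (auto simp: c_def)
  ultimately have q: "norm \<xi> = 1 + q"
    using assms(2,3) by simp
  have "\<xi> = (1 / c) *\<^sub>R (c *\<^sub>R \<xi>)"
    using c(1) by simp
  also have "\<dots> = - ((q / c) *\<^sub>R e)"
    unfolding c(2) by simp
  also have "q / c = 1 + q"
    using q assms(1) by (simp add: c_def)
  finally show ?thesis .
qed

text \<open>The comparison argument for an abstract field V = a(|x|) x: only its continuity off the
  origin, its boundedness and its weak divergence enter, so rearrangements stay out of it.\<close>

lemma radial_weak_solution:
  fixes u :: "'a::euclidean_space \<Rightarrow> real"
  assumes R: "R > 0" and p: "p > 1"
    and sol: "weak_solution (ball 0 R) p f u Du"
    and a [measurable]: "a \<in> borel_measurable borel" and a_nonneg: "\<And>r. 0 \<le> a r"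
    and a_cont: "continuous_on {0<..<R} a" and a_le: "\<And>r. 0 < r \<Longrightarrow> r < R \<Longrightarrow> r * a r \<le> C"
    and a_weak: "\<And>\<phi>. \<phi> \<in> test_functions (ball 0 R) \<Longrightarrow>
      (\<integral>x. a (norm x) * (x \<bullet> grad \<phi> x) \<partial>lebesgue_on (ball 0 R)) =
      - (\<integral>x. f x * \<phi> x \<partial>lebesgue_on (ball 0 R))"
  shows "AE x in lebesgue_on (ball 0 R).
    H 1 (Du x) = - (((norm x * a (norm x)) powr (1 / (p - 1))) *\<^sub>R (x /\<^sub>R norm x))"
proof -
  define M where "M = lebesgue_on (ball (0::'a) R)"
  have M: "space M = ball 0 R"
    by (simp add: M_def)
  interpret finite_measure M
    unfolding M_def by (rule finite_measure_lebesgue_on) simp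
  have id [measurable]: "(\<lambda>x. x) \<in> borel_measurable M"
    unfolding M_def by (intro measurable_restrict_space1 measurable_completion) simp
  have C: "C \<ge> 0"
    using a_le[of "R / 2"] a_nonneg[of "R / 2"] R mult_nonneg_nonneg[of "R / 2" "a (R / 2)"] by linarith
  have a_le': "norm x * a (norm x) \<le> C" if "x \<in> space M" for x
    using a_le[of "norm x"] that C by (cases "x = 0") (auto simp: M)

  \<comment> \<open>The approximation comes with its own representative \<open>E\<close> of the
    gradient, known to be in L^p, while \<open>Du\<close> is a priori only locally integrable. The
    argument runs with \<open>E\<close> and returns to \<open>Du\<close> at the end.\<close>
  obtain E \<phi> where E: "has_weak_gradient (ball 0 R) u E" "E \<in> Lp_on (ball 0 R) p"
    and \<phi>: "\<And>n. \<phi> n \<in> test_functions (ball 0 R)"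
    and \<phi>_lim: "(\<lambda>n::nat. (\<integral>x. \<bar>\<phi> n x - u x\<bar> powr p \<partial>M) + (\<integral>x. norm (grad (\<phi> n) x - E x) powr p \<partial>M))
      \<longlonglongrightarrow> 0"
    using sol unfolding weak_solution_def sobolev_W1_0_def M_def by blast
  have Du: "has_weak_gradient (ball 0 R) u Du"
    using sol by (simp add: weak_solution_def)
  have Du_E: "AE x in M. Du x = E x"
    unfolding M_def using weak_gradient_unique[OF open_ball Du E(1)] .
  have [measurable]: "Du \<in> borel_measurable M"
    unfolding M_def using Du R
    by (intro borel_measurable_if_locally_integrable_on_ball) (auto simp: has_weak_gradient_def)
  have E_meas [measurable]: "E \<in> borel_measurable M" and E_int: "integrable M (\<lambda>x. norm (E x) powr p)"
    using E(2) by (auto simp: Lp_on_def M_def)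
  have grad_meas: "grad \<psi> \<in> borel_measurable M" if "\<psi> \<in> test_functions (ball 0 R)" for \<psi>
    using measurable_compose[OF id borel_measurable_continuous_onI[OF test_function_continuous_grad[OF that]]]
    by simp

  define F where "F = (\<lambda>x. H (p - 1) (E x) + a (norm x) *\<^sub>R x)"
  \<comment> \<open>With this constant the bounded field V satisfies |V| <= c0^(p-1), so both parts
    of F are bounded by m^(p-1) for m = max(|E|, c0).\<close>
  define c0 where "c0 = C powr (1 / (p - 1))"
  define m where "m = (\<lambda>x. max (norm (E x)) c0)"
  have c0: "c0 \<ge> 0" "c0 powr (p - 1) = C"
    using C p by (auto simp: c0_def powr_powr)
  have m: "m x \<ge> 0" for x
    by (simp add: m_def le_max_iff_disj)
  have H_meas [measurable]: "(\<lambda>x. H (p - 1) (E x)) \<in> borel_measurable M"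
      "(\<lambda>x. H (p - 1) (Du x)) \<in> borel_measurable M"
    unfolding H_eq by measurable
  have F_meas [measurable]: "F \<in> borel_measurable M"
    unfolding F_def by measurable
  have F_le: "norm (F x) \<le> 2 * m x powr (p - 1)" if x: "x \<in> space M" for x
  proof -
    have "norm (H (p - 1) (E x)) \<le> max 0 (norm (E x) - 1) powr (p - 1)"
      by (simp add: H_eq)
    also have "\<dots> \<le> m x powr (p - 1)"
      using p by (intro powr_mono2) (auto simp: m_def le_max_iff_disj)
    finally have 1: "norm (H (p - 1) (E x)) \<le> m x powr (p - 1)" .
    have "norm (a (norm x) *\<^sub>R x) \<le> c0 powr (p - 1)"
      using a_le'[OF x] a_nonneg[of "norm x"] c0 by (simp add: mult.commute)
    also have "\<dots> \<le> m x powr (p - 1)"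
      using p c0 by (intro powr_mono2) (auto simp: m_def le_max_iff_disj)
    finally show ?thesis
      unfolding F_def using 1 norm_triangle_ineq[of "H (p - 1) (E x)" "a (norm x) *\<^sub>R x"] by linarith
  qed
  have m_int: "integrable M (\<lambda>x. m x powr p)"
  proof (rule Bochner_Integration.integrable_bound)
    show "integrable M (\<lambda>x. norm (E x) powr p + c0 powr p)"
      using E_int by simp
    show "AE x in M. norm (m x powr p) \<le> norm (norm (E x) powr p + c0 powr p)"
      by (intro AE_I2) (simp add: m_def max_def)
  qed (simp add: m_def)
  \<comment> \<open>Young's inequality with t = \<epsilon> = 1 gives m^(p-1) <= m^p + 1, integrable
    on the bounded ball.\<close>
  have F_int: "integrable M F"
  proof (rule Bochner_Integration.integrable_bound)
    show "integrable M (\<lambda>x. 2 * (m x powr p + 1))"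
      using m_int by simp
    show "AE x in M. norm (F x) \<le> norm (2 * (m x powr p + 1))"
    proof (rule AE_I2)
      fix x assume "x \<in> space M"
      then show "norm (F x) \<le> norm (2 * (m x powr p + 1))"
        using F_le[of x] powr_mult_le_weighted_sum[OF p m[of x], of 1 1] by simp
    qed
  qed measurable
  have F_orth: "(\<integral>x. F x \<bullet> grad \<psi> x \<partial>M) = 0" and F_grad_int: "integrable M (\<lambda>x. F x \<bullet> grad \<psi> x)"
    if \<psi>: "\<psi> \<in> test_functions (ball 0 R)" for \<psi>
  proof -
    note [measurable] = grad_meas[OF \<psi>]
    obtain B where B: "B \<ge> 0" "\<And>x. norm (grad \<psi> x) \<le> B"
      using test_function_bounded[OF \<psi>] by metis
    show int: "integrable M (\<lambda>x. F x \<bullet> grad \<psi> x)"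
    proof (rule Bochner_Integration.integrable_bound)
      show "integrable M (\<lambda>x. B * norm (F x))"
        using F_int by simp
      show "AE x in M. norm (F x \<bullet> grad \<psi> x) \<le> norm (B * norm (F x))"
      proof (rule AE_I2)
        fix x
        show "norm (F x \<bullet> grad \<psi> x) \<le> norm (B * norm (F x))"
          using Cauchy_Schwarz_ineq2[of "F x" "grad \<psi> x"] B(1)
            mult_left_mono[OF B(2)[of x] norm_ge_zero[of "F x"]] by (simp add: mult.commute)
      qed
    qed measurable
    have int_a: "integrable M (\<lambda>x. a (norm x) * (x \<bullet> grad \<psi> x))"
    proof (rule Bochner_Integration.integrable_bound)
      show "integrable M (\<lambda>x. C * B)"
        by simp
      show "AE x in M. norm (a (norm x) * (x \<bullet> grad \<psi> x)) \<le> norm (C * B)"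
      proof (rule AE_I2)
        fix x assume x: "x \<in> space M"
        have "\<bar>a (norm x) * (x \<bullet> grad \<psi> x)\<bar> \<le> a (norm x) * (norm x * norm (grad \<psi> x))"
          unfolding abs_mult using a_nonneg[of "norm x"] Cauchy_Schwarz_ineq2[of x "grad \<psi> x"]
          by (simp add: mult_left_mono)
        also have "\<dots> = norm x * a (norm x) * norm (grad \<psi> x)"
          by simp
        also have "\<dots> \<le> C * B"
          using a_le'[OF x] B a_nonneg C by (intro mult_mono) auto
        finally show "norm (a (norm x) * (x \<bullet> grad \<psi> x)) \<le> norm (C * B)"
          using B C by simp
      qed
    qed measurable
    have "(\<integral>x. H (p - 1) (E x) \<bullet> grad \<psi> x \<partial>M) = (\<integral>x. H (p - 1) (Du x) \<bullet> grad \<psi> x \<partial>M)"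
    proof (rule integral_cong_AE)
      show "AE x in M. H (p - 1) (E x) \<bullet> grad \<psi> x = H (p - 1) (Du x) \<bullet> grad \<psi> x"
        using Du_E by eventually_elim simp
    qed measurable
    also have "\<dots> = (\<integral>x. f x * \<psi> x \<partial>M)"
      using sol \<psi> unfolding weak_solution_def M_def by blast
    finally have "(\<integral>x. F x \<bullet> grad \<psi> x - a (norm x) * (x \<bullet> grad \<psi> x) \<partial>M) = (\<integral>x. f x * \<psi> x \<partial>M)"
      by (simp add: F_def inner_add_left)
    then show "(\<integral>x. F x \<bullet> grad \<psi> x \<partial>M) = 0"
      using int int_a a_weak[OF \<psi>] by (simp add: M_def)
  qed

  \<comment> \<open>Integrals of nonintegrable functions are 0, so the convergence in
    \<open>sobolev_W1_0\<close> has content only once integrability is known.\<close>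
  have d_int: "integrable M (\<lambda>x. norm (grad (\<phi> n) x - E x) powr p)" for n
  proof -
    obtain B where B: "B \<ge> 0" "\<And>x. norm (grad (\<phi> n) x) \<le> B"
      using test_function_bounded[OF \<phi>[of n]] by metis
    show ?thesis
    proof (rule Bochner_Integration.integrable_bound)
      show "integrable M (\<lambda>x. 2 powr p * (B powr p + norm (E x) powr p))"
        using E_int by simp
      show "AE x in M. norm (norm (grad (\<phi> n) x - E x) powr p)
          \<le> norm (2 powr p * (B powr p + norm (E x) powr p))"
      proof (rule AE_I2)
        fix x
        have "norm (grad (\<phi> n) x - E x) \<le> 2 * max B (norm (E x))"
          using norm_triangle_ineq4[of "grad (\<phi> n) x" "E x"] B(2)[of x] by linarith
        then have "norm (grad (\<phi> n) x - E x) powr p \<le> (2 * max B (norm (E x))) powr p"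
          using p by (intro powr_mono2) auto
        also have "\<dots> = 2 powr p * max B (norm (E x)) powr p"
          by (rule powr_mult)
        also have "\<dots> \<le> 2 powr p * (B powr p + norm (E x) powr p)"
          by (intro mult_left_mono) (auto simp: max_def)
        finally show "norm (norm (grad (\<phi> n) x - E x) powr p)
            \<le> norm (2 powr p * (B powr p + norm (E x) powr p))"
          by simp
      qed
    qed (use grad_meas[OF \<phi>] in measurable)
  qed
  have d_lim: "(\<lambda>n. \<integral>x. norm (grad (\<phi> n) x - E x) powr p \<partial>M) \<longlonglongrightarrow> 0"
  proof (rule tendsto_sandwich[OF _ _ tendsto_const \<phi>_lim])
    show "\<forall>\<^sub>F n in sequentially. (\<integral>x. norm (grad (\<phi> n) x - E x) powr p \<partial>M) \<le>
        (\<integral>x. \<bar>\<phi> n x - u x\<bar> powr p \<partial>M) + (\<integral>x. norm (grad (\<phi> n) x - E x) powr p \<partial>M)"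
      by simp
  qed simp
  have d_meas: "(\<lambda>x. grad (\<phi> n) x - E x) \<in> borel_measurable M" for n
    by (intro borel_measurable_diff grad_meas[OF \<phi>] E_meas)
  note limit = integral_inner_tendsto_0[where M=M and F=F and d="\<lambda>n x. grad (\<phi> n) x - E x" and m=m,
      OF p F_meas d_meas m m_int F_le _ d_int d_lim]
  have FE_int: "integrable M (\<lambda>x. F x \<bullet> E x)"
    using Bochner_Integration.integrable_diff[OF F_grad_int[OF \<phi>[of 0]] limit(1)[of 0]]
    by (simp add: inner_diff_right)
  \<comment> \<open>Orthogonality removes the part with grad \<phi>, so the sequence tending to 0 is
    constant in n.\<close>
  have "(\<integral>x. F x \<bullet> (grad (\<phi> n) x - E x) \<partial>M) = - (\<integral>x. F x \<bullet> E x \<partial>M)" for n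
    using F_orth[OF \<phi>[of n]] F_grad_int[OF \<phi>[of n]] FE_int by (simp add: inner_diff_right)
  with limit(2) have FE: "(\<integral>x. F x \<bullet> E x \<partial>M) = 0"
    by (simp add: LIMSEQ_const_iff)

  define b where "b = (\<lambda>r. (r * a r) powr (1 / (p - 1)))"
  have w_cont: "continuous_on {0<..<R} (\<lambda>r. 1 + b r)"
    unfolding b_def using p a_nonneg
    by (intro continuous_intros a_cont continuous_on_powr') auto
  have w_le: "\<bar>1 + b r\<bar> \<le> 1 + c0" if "0 < r" "r < R" for r
    using a_le[OF that] a_nonneg[of r] that p by (simp add: b_def c0_def powr_mono2)
  note radial = integral_radial_direction_eq_0[OF R F_int[unfolded M_def] F_orth[unfolded M_def] w_cont w_le,
      folded M_def]
  \<comment> \<open>The integrand of the comparison with - w x / |x|, where w = 1 + b. Both summands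
    have integral 0.\<close>
  define I where "I = (\<lambda>x. F x \<bullet> E x + (1 + b (norm x)) / norm x * (F x \<bullet> x))"
  have I_int: "integrable M I"
    unfolding I_def using FE_int radial(2) by simp
  have I_0: "(\<integral>x. I x \<partial>M) = 0"
    unfolding I_def using FE_int radial FE by simp
  have AE_0: "AE x in M. x \<noteq> 0"
    unfolding M_def by (rule AE_lebesgue_on_neq) simp
  \<comment> \<open>This is the shape of \<open>H_monotone\<close> with e = - x / |x|; the exponent
    in b is chosen so that b^(p-1) = |V|.\<close>
  have I_eq: "I x = (H (p - 1) (E x) - (b (norm x) powr (p - 1)) *\<^sub>R (- (x /\<^sub>R norm x))) \<bullet>
      (E x - (1 + b (norm x)) *\<^sub>R (- (x /\<^sub>R norm x)))" if "x \<noteq> 0" for x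
  proof -
    have "b (norm x) powr (p - 1) = norm x * a (norm x)"
      using p a_nonneg[of "norm x"] by (simp add: b_def powr_powr)
    then have "(b (norm x) powr (p - 1)) *\<^sub>R (- (x /\<^sub>R norm x)) = - (a (norm x) *\<^sub>R x)"
      using that by simp
    then have F_eq: "H (p - 1) (E x) - (b (norm x) powr (p - 1)) *\<^sub>R (- (x /\<^sub>R norm x)) = F x"
      by (simp only: F_def diff_minus_eq_add)
    show ?thesis
      unfolding F_eq I_def by (simp add: inner_add_right divide_inverse mult.commute)
  qed
  have b_nonneg: "b r \<ge> 0" for r
    by (simp add: b_def)
  have unit: "norm (- (x /\<^sub>R norm x)) = 1" if "x \<noteq> 0" for x :: 'a
    using that by simp
  have I_nonneg: "0 \<le> I x" if "x \<noteq> 0" for x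
    unfolding I_eq[OF that] by (rule H_monotone(1)[OF p b_nonneg unit[OF that]])
  have "AE x in M. 0 \<le> I x"
    using AE_0 by eventually_elim (rule I_nonneg)
  then have "AE x in M. I x = 0"
    using I_0 integral_nonneg_eq_0_iff_AE[OF I_int] by blast
  then show ?thesis
    using AE_0 Du_E unfolding M_def[symmetric]
  proof eventually_elim
    case (elim x)
    have "H 1 (E x) = b (norm x) *\<^sub>R (- (x /\<^sub>R norm x))"
      using elim(1) unfolding I_eq[OF elim(2)] by (rule H_monotone(2)[OF p b_nonneg unit[OF elim(2)]])
    then show ?case
      using elim by (simp add: b_def)
  qed
qed

section \<open>From the datum f to its radial field\<close>

lemma radially_decreasing_profile:
  assumes "radially_decreasing R f" "AE x in lebesgue_on (ball 0 R). 0 \<le> f x"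
  obtains g where "antimono_on {0<..} g" "\<And>t. 0 \<le> g t" "\<And>t. t \<le> 0 \<Longrightarrow> g t = 0"
    "AE x in lebesgue_on (ball (0::'a::euclidean_space) R). f x = g (norm x)"
proof -
  obtain g0 where g0: "antimono_on {0<..<R} g0" "AE x in lebesgue_on (ball 0 R). f x = g0 (norm x)"
    using assms(1) by (auto simp: radially_decreasing_def)
  \<comment> \<open>The positive part turns the a.e. sign of f into a pointwise one for the profile,
    and it keeps the extension by 0 beyond R decreasing. The value 0 at the origin changes f on a
    null set only.\<close>
  define g where "g = (\<lambda>t. if 0 < t \<and> t < R then max 0 (g0 t) else 0)"
  have AE_0: "AE x in lebesgue_on (ball (0::'a) R). x \<noteq> 0"
    by (rule AE_lebesgue_on_neq) simp
  show ?thesis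
  proof
    show "antimono_on {0<..} g"
    proof (rule monotone_onI)
      fix s t :: real assume "s \<in> {0<..}" "t \<in> {0<..}" "s \<le> t"
      then show "g t \<le> g s"
        using monotone_onD[OF g0(1), of s t] by (auto simp: g_def)
    qed
    show "AE x in lebesgue_on (ball 0 R). f x = g (norm x)"
      using g0(2) assms(2) AE_0 AE_space by eventually_elim (auto simp: g_def)
  qed (auto simp: g_def)
qed

text \<open>At the volume T of the ball of radius r the weight T^(1/N) is a constant times r, so the
  norm of exponent N controls exactly r A(r).\<close>

lemma weak_lorentz_radial_bound:
  fixes f :: "'a::euclidean_space \<Rightarrow> real" and g :: "real \<Rightarrow> real"
  defines "A \<equiv> \<lambda>r. \<integral>\<^sup>+s\<in>{0..1}. ennreal (g (r * s) * s ^ (DIM('a) - 1)) \<partial>lborel"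
  assumes f: "f \<in> weak_lorentz (ball 0 R) (real DIM('a))"
    and f_eq: "AE x in lebesgue_on (ball 0 R). f x = g (norm x)"
    and g: "antimono_on {0<..} g" "\<And>t. 0 \<le> g t" "\<And>t. t \<le> 0 \<Longrightarrow> g t = 0"
  obtains C where "\<And>r. 0 < r \<Longrightarrow> r < R \<Longrightarrow> ennreal r * A r \<le> ennreal C"
proof -
  define V W v where "V = measure lebesgue (ball (0::'a) 1)"
    and "W = weak_lorentz_norm (ball 0 R) (real DIM('a)) f" and "v = V powr (1 / DIM('a))"
  have V: "V > 0"
    by (simp add: V_def content_ball)
  then have v: "v > 0"
    by (simp add: v_def)
  have f_meas: "f \<in> borel_measurable (lebesgue_on (ball 0 R))" and W: "W < \<infinity>"
    using f by (auto simp: weak_lorentz_def W_def)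
  have "ennreal r * A r \<le> ennreal (enn2real (ennreal (1 / v) * W))" if r: "0 < r" "r < R" for r
  proof -
    define T where "T = V * r ^ DIM('a)"
    have T: "T > 0"
      using V r by (simp add: T_def)
    have "T powr (1 / DIM('a)) = v * r"
      using V r by (simp add: T_def v_def powr_mult powr_realpow[symmetric] powr_powr)
    moreover have "max_rearr (ball 0 R) f T = ennreal DIM('a) * A r"
      using max_rearr_radial[OF f_meas f_eq g r] by (simp add: T_def V_def A_def)
    moreover have "ennreal (T powr (1 / DIM('a))) * max_rearr (ball 0 R) f T \<le> W"
      unfolding W_def weak_lorentz_norm_def using T by (intro SUP_upper) simp
    ultimately have le: "ennreal (v * r) * (ennreal DIM('a) * A r) \<le> W"
      by simp
    \<comment> \<open>The explicit factor 1 is there to be enlarged to N in the next step.\<close>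
    have "ennreal r * A r = ennreal (1 / v) * (ennreal (v * r) * (1 * A r))"
      using v r by (simp add: mult.assoc[symmetric] ennreal_mult'[symmetric])
    also have "\<dots> \<le> ennreal (1 / v) * (ennreal (v * r) * (ennreal DIM('a) * A r))"
      using DIM_positive[where 'a='a]
      by (intro mult_left_mono mult_right_mono) (auto simp: Suc_le_eq simp flip: ennreal_1)
    also have "\<dots> \<le> ennreal (1 / v) * W"
      using le by (intro mult_left_mono) auto
    also have "\<dots> = ennreal (enn2real (ennreal (1 / v) * W))"
      using W by (simp add: ennreal_mult_less_top)
    finally show ?thesis .
  qed
  then show ?thesis
    using that by blast
qed

theorem theorem1p1:
  fixes R p :: real
    and f u :: "real ^ 'n \<Rightarrow> real"
    and Du :: "real ^ 'n \<Rightarrow> real ^ 'n"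
  assumes "CARD('n) \<ge> 2" and "R > 0" and "p > 1"
    and "f \<in> weak_lorentz (ball 0 R) (real CARD('n))"
    and "AE x in lebesgue_on (ball 0 R). 0 \<le> f x"
    and "radially_decreasing R f"
    and "weak_solution (ball 0 R) p f u Du"
  shows "(AE x in lebesgue_on (ball 0 R).
            H 1 (Du x) = - ((flux R f x powr (1 / (p - 1))) *\<^sub>R (x /\<^sub>R norm x))) \<and>
         (AE x in lebesgue_on (ball 0 R). norm (Du x) > 1 \<longrightarrow>
            Du x = - ((1 + flux R f x powr (1 / (p - 1))) *\<^sub>R (x /\<^sub>R norm x)))"
proof -
  define N where "N = DIM(real ^ 'n)"
  have N: "CARD('n) = N" "N > 0"
    by (auto simp: N_def)
  obtain g where g: "antimono_on {0<..} g" "\<And>t. 0 \<le> g t" "\<And>t. t \<le> 0 \<Longrightarrow> g t = 0"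
    and f_eq: "AE x in lebesgue_on (ball 0 R). f x = g (norm x)"
    using radially_decreasing_profile[OF assms(6,5)] by metis
  have f: "f \<in> weak_lorentz (ball 0 R) (real DIM(real ^ 'n))"
    using assms(4) by simp
  then have f_meas: "f \<in> borel_measurable (lebesgue_on (ball 0 R))"
    by (simp add: weak_lorentz_def)
  have g_meas [measurable]: "g \<in> borel_measurable borel"
    by (rule borel_measurable_if_antimono_on_halfline[OF g(1,3)])
  define A where "A = (\<lambda>r. \<integral>\<^sup>+s\<in>{0..1}. ennreal (g (r * s) * s ^ (N - 1)) \<partial>lborel)"
  define a where "a = (\<lambda>r. enn2real (A r))"
  obtain C where C: "\<And>r. 0 < r \<Longrightarrow> r < R \<Longrightarrow> ennreal r * A r \<le> ennreal C"
    using weak_lorentz_radial_bound[OF f f_eq g] unfolding A_def N_def by metis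
  have A_fin: "A r < \<infinity>" if "0 < r" "r < R" for r
    using C[OF that] that by (auto simp: less_top[symmetric] ennreal_mult_top top_unique)
  have a_meas: "a \<in> borel_measurable borel"
    unfolding a_def A_def by measurable
  have a_eq: "AE x in lebesgue_on (ball 0 R).
      H 1 (Du x) = - (((norm x * a (norm x)) powr (1 / (p - 1))) *\<^sub>R (x /\<^sub>R norm x))"
  proof (rule radial_weak_solution[OF assms(2,3,7) a_meas])
    show "0 \<le> a r" for r
      by (simp add: a_def)
    show "continuous_on {0<..<R} a"
      unfolding a_def A_def
      by (rule continuous_on_radial_mean[OF g_meas g(2) N(2)]) (use A_fin in \<open>simp add: A_def\<close>)
    \<comment> \<open>\<open>ennreal\<close> sends negative reals to 0, so the bound in the extended
      reals does not exclude a negative \<open>C\<close>.\<close>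
    show "r * a r \<le> max 0 C" if r: "0 < r" "r < R" for r
    proof -
      have "ennreal (r * a r) = ennreal r * A r"
        using A_fin[OF r] r by (simp add: a_def ennreal_mult)
      also have "\<dots> \<le> ennreal (max 0 C)"
        using C[OF r] by (simp add: ennreal_max_0)
      finally show ?thesis
        by (simp add: ennreal_le_iff)
    qed
    fix \<phi> :: "real ^ 'n \<Rightarrow> real" assume \<phi>: "\<phi> \<in> test_functions (ball 0 R)"
    have [measurable]: "grad \<phi> \<in> borel_measurable borel" "\<phi> \<in> borel_measurable borel"
      using \<phi> by (auto intro!: borel_measurable_continuous_onI test_function_continuous
          test_function_continuous_grad)
    note [measurable] = a_meas
    have "(\<integral>x. a (norm x) * (x \<bullet> grad \<phi> x) \<partial>lebesgue_on (ball 0 R)) =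
        (\<integral>x. a (norm x) * (x \<bullet> grad \<phi> x) \<partial>lborel)"
      using test_function_eq_0(2)[OF \<phi>] by (intro integral_lebesgue_on_eq_lborel) auto
    also have "\<dots> = - (\<integral>x. g (norm x) * \<phi> x \<partial>lborel)"
      using integral_radial_mean_grad[OF \<phi> assms(2) g_meas g(2), of C] C
      unfolding a_def A_def N_def by blast
    also have "(\<integral>x. g (norm x) * \<phi> x \<partial>lborel) = (\<integral>x. g (norm x) * \<phi> x \<partial>lebesgue_on (ball 0 R))"
      using test_function_eq_0(1)[OF \<phi>] by (intro integral_lebesgue_on_eq_lborel[symmetric]) auto
    also have "\<dots> = (\<integral>x. f x * \<phi> x \<partial>lebesgue_on (ball 0 R))"
    proof (rule integral_cong_AE)
      show "AE x in lebesgue_on (ball 0 R). g (norm x) * \<phi> x = f x * \<phi> x"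
        using f_eq by eventually_elim simp
      have \<phi>_meas: "\<phi> \<in> borel_measurable (lebesgue_on (ball 0 R))"
        and "(\<lambda>x. g (norm x) * \<phi> x) \<in> borel_measurable (lebesgue_on (ball 0 R))"
        by (intro measurable_restrict_space1 measurable_completion, simp)+
      then show "(\<lambda>x. g (norm x) * \<phi> x) \<in> borel_measurable (lebesgue_on (ball 0 R))"
        by simp
      show "(\<lambda>x. f x * \<phi> x) \<in> borel_measurable (lebesgue_on (ball 0 R))"
        by (rule borel_measurable_times[OF f_meas \<phi>_meas])
    qed
    finally show "(\<integral>x. a (norm x) * (x \<bullet> grad \<phi> x) \<partial>lebesgue_on (ball 0 R)) =
        - (\<integral>x. f x * \<phi> x \<partial>lebesgue_on (ball 0 R))" .
  qed
  \<comment> \<open>The factor 1 / N in \<open>flux\<close> cancels the N of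
    \<open>max_rearr_radial\<close>; at the origin both sides are 0 because of
    \<open>norm x\<close>.\<close>
  have flux: "norm x * a (norm x) = flux R f x" if "x \<in> ball 0 R" for x
  proof (cases "x = 0")
    case False
    then have "max_rearr (ball 0 R) f (measure lebesgue (ball 0 1 :: (real ^ 'n) set) * norm x ^ CARD('n)) =
        ennreal N * A (norm x)"
      using max_rearr_radial[OF f_meas f_eq g, of "norm x"] that by (simp add: A_def N_def)
    then show ?thesis
      using N by (simp add: flux_def a_def enn2real_mult)
  qed (simp add: flux_def)
  have first: "AE x in lebesgue_on (ball 0 R).
      H 1 (Du x) = - ((flux R f x powr (1 / (p - 1))) *\<^sub>R (x /\<^sub>R norm x))"
    using a_eq AE_space by eventually_elim (simp add: flux)
  have "AE x in lebesgue_on (ball 0 R). x \<noteq> (0 :: real ^ 'n)"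
    by (rule AE_lebesgue_on_neq) simp
  with first have "AE x in lebesgue_on (ball 0 R). norm (Du x) > 1 \<longrightarrow>
      Du x = - ((1 + flux R f x powr (1 / (p - 1))) *\<^sub>R (x /\<^sub>R norm x))"
  proof eventually_elim
    case (elim x)
    show ?case
      using elim by (intro impI H_1_eq_imp) auto
  qed
  with first show ?thesis
    by blast
qed

end
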